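(* Let $G$ be a compact group with normalized Haar measure $m_G$, let $X$ be a complex Banach space, let $\Phi$ be a Young function, and let $\nu$ be a nonzero $X$-valued vector measure on $G$ which is absolutely continuous with respect to $m_G$ and norm integral translation invariant. Let $f\in L^1(G)$ and $g\in L^\Phi_w(\nu)$. Then $f*g\in L^\Phi_w(\nu)$ and $$\|f*g\|_{\nu,\Phi}\le\|f\|_1\,\|g\|_{\nu,\Phi}.$$ In particular, if $g\in L^\Phi(\nu)$, then $f*g\in L^\Phi(\nu)$.
   Context: $\mathcal{B}(G)$ is the Borel $\sigma$-algebra of $G$; $L^1(G)$ is taken with respect to $m_G$, with norm $\|\cdot\|_1$. A vector measure $\nu$ is a $\sigma$-additive map $\mathcal{B}(G)\to X$. $X'$ is the topological dual of $X$, $B_{X'}$ its closed unit ball; for $x'\in X'$, $\langle\nu,x'\rangle(A)=\langle\nu(A),x'\rangle$ is a complex measure with total variation $|\langle\nu,x'\rangle|$. $\nu$ is absolutely continuous w.r.t. $m_G$ if $\nu(A)\to0$ as $m_G(A)\to 0$. A set $A$ is $\nu$-null if $\nu(B)=0$ for all Borel $B\subset A$; functions equal off a $\nu$-null set are identified. $\tau_s f(t)=f(s^{-1}t)$. For a simple function $\phi=\sum_i\alpha_i\chi_{A_i}$, $I_\nu(\phi)=\int_G\phi\,d\nu=\sum_i\alpha_i\nu(A_i)$. $\nu$ is norm integral translation invariant if $\|I_\nu(\tau_s\phi)\|=\|I_\nu(\phi)\|$ for every simple function $\phi$ on $G$ and every $s\in G$. A Young function is a strictly increasing, convex, continuous $\Phi:[0,\infty)\to[0,\infty)$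 with $\Phi(t)=0$ iff $t=0$ and $\lim_{t\to\infty}\Phi(t)=\infty$. For a finite positive measure $\mu$, $\|f\|_{L^\Phi(\mu)}=\inf\{k>0:\int_G\Phi(|f|/k)\,d\mu\le 1\}$. $L^\Phi_w(\nu)$ is the space of complex measurable $f$ with $\|f\|_{\nu,\Phi}=\sup_{x'\in B_{X'}}\|f\|_{L^\Phi(|\langle\nu,x'\rangle|)}<\infty$, and $L^\Phi(\nu)$ is the closure of the simple functions in it under $\|\cdot\|_{\nu,\Phi}$. For such $\nu$, $\nu$-null sets and $m_G$-null sets coincide and $L^\Phi_w(\nu)\subset L^1(G)$, so the usual convolution $f*g(t)=\int_G f(s)g(s^{-1}t)\,dm_G(s)$ is defined. *)

theory Defs
  imports "HOL-Analysis.Analysis"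
begin

section \<open>Complex Banach spaces\<close>

text \<open>The library has real normed spaces only; a complex Banach space is a real one with
  a compatible complex scalar multiplication for which the norm is homogeneous.\<close>

class scaleC =
  fixes scaleC :: "complex \<Rightarrow> 'a \<Rightarrow> 'a"  (infixr \<open>*\<^sub>C\<close> 75)

class complex_banach = banach + scaleC +
  assumes scaleC_add_right: "a *\<^sub>C (x + y) = a *\<^sub>C x + a *\<^sub>C y"
    and scaleC_add_left: "(a + b) *\<^sub>C x = a *\<^sub>C x + b *\<^sub>C x"
    and scaleC_scaleC: "a *\<^sub>C (b *\<^sub>C x) = (a * b) *\<^sub>C x"
    and scaleC_of_real: "complex_of_real r *\<^sub>C x = r *\<^sub>R x"
    and norm_scaleC: "norm (a *\<^sub>C x) = cmod a * norm x"

instantiation complex :: complex_banach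
begin

definition scaleC_complex :: "complex \<Rightarrow> complex \<Rightarrow> complex"
  where "scaleC_complex a x = a * x"

instance
  by standard (auto simp: scaleC_complex_def algebra_simps norm_mult scaleR_conv_of_real)

end

definition dual_space :: "('x::complex_banach \<Rightarrow> complex) set" where
  "dual_space = {x'. bounded_linear x' \<and> (\<forall>c x. x' (c *\<^sub>C x) = c * x' x)}"

definition dual_unit_ball :: "('x::complex_banach \<Rightarrow> complex) set" where
  "dual_unit_ball = {x' \<in> dual_space. onorm x' \<le> 1}"


section \<open>Haar measure\<close>

text \<open>Groups are written additively, since this is how the library provides topological groups;
  the class \<open>topological_group_add\<close> does not assume commutativity. Thus \<open>s + t\<close> is the
  product \<open>st\<close> and \<open>- s + t\<close> is \<open>s\<^sup>-\<^sup>1t\<close>.\<close>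

definition normalized_haar_measure :: "'g::topological_group_add measure \<Rightarrow> bool" where
  "normalized_haar_measure m \<longleftrightarrow>
     sets m = sets borel \<and>
     emeasure m UNIV = 1 \<and>
     (\<forall>s. \<forall>A \<in> sets borel. emeasure m ((+) s ` A) = emeasure m A) \<and>
     (\<forall>A \<in> sets borel. emeasure m A = (INF U \<in> {U. open U \<and> A \<subseteq> U}. emeasure m U)) \<and>
     (\<forall>U. open U \<longrightarrow> emeasure m U = (SUP K \<in> {K. compact K \<and> K \<subseteq> U}. emeasure m K))"

definition translate :: "'g::group_add \<Rightarrow> ('g \<Rightarrow> complex) \<Rightarrow> 'g \<Rightarrow> complex" where
  "translate s f = (\<lambda>t. f (- s + t))"

definition group_convolution ::
    "'g::topological_group_add measure \<Rightarrow> ('g \<Rightarrow> complex) \<Rightarrow> ('g \<Rightarrow> complex) \<Rightarrow> 'g \<Rightarrow> complex" where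
  "group_convolution m f g = (\<lambda>t. LINT s|m. f s * g (- s + t))"


section \<open>Vector measures\<close>

text \<open>Only the values on Borel sets are relevant.\<close>

definition vector_measure :: "('g::topological_space set \<Rightarrow> 'x::real_normed_vector) \<Rightarrow> bool" where
  "vector_measure \<nu> \<longleftrightarrow>
     (\<forall>A :: nat \<Rightarrow> 'g set. range A \<subseteq> sets borel \<longrightarrow> disjoint_family A \<longrightarrow>
        (\<lambda>n. \<nu> (A n)) sums \<nu> (\<Union>n. A n))"

definition abs_continuous ::
    "'g::topological_space measure \<Rightarrow> ('g set \<Rightarrow> 'x::real_normed_vector) \<Rightarrow> bool" where
  "abs_continuous m \<nu> \<longleftrightarrow>
     (\<forall>\<epsilon>>0. \<exists>\<delta>>0. \<forall>A \<in> sets borel. measure m A < \<delta> \<longrightarrow> norm (\<nu> A) < \<epsilon>)"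

text \<open>The integral of a simple function, taken over its canonical representation
  \<open>\<phi> = \<Sum>y \<in> range \<phi>. y \<chi>\<^bsub>\<phi> -` {y}\<^esub>\<close>.\<close>

definition simple_vector_integral ::
    "('g::topological_space set \<Rightarrow> 'x::complex_banach) \<Rightarrow> ('g \<Rightarrow> complex) \<Rightarrow> 'x" where
  "simple_vector_integral \<nu> \<phi> = (\<Sum>y \<in> range \<phi>. y *\<^sub>C \<nu> (\<phi> -` {y}))"

definition norm_integral_translation_invariant ::
    "('g::topological_group_add set \<Rightarrow> 'x::complex_banach) \<Rightarrow> bool" where
  "norm_integral_translation_invariant \<nu> \<longleftrightarrow>
     (\<forall>\<phi> s. simple_function borel \<phi> \<longrightarrow>
        norm (simple_vector_integral \<nu> (translate s \<phi>)) = norm (simple_vector_integral \<nu> \<phi>))"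


section \<open>Total variation\<close>

definition variation :: "('g::topological_space set \<Rightarrow> complex) \<Rightarrow> 'g set \<Rightarrow> ennreal" where
  "variation \<mu> E =
     (SUP A \<in> {A :: nat \<Rightarrow> 'g set. range A \<subseteq> sets borel \<and> disjoint_family A \<and> (\<Union>n. A n) = E}.
        \<Sum>n. ennreal (cmod (\<mu> (A n))))"

definition variation_measure :: "('g::topological_space set \<Rightarrow> complex) \<Rightarrow> 'g measure" where
  "variation_measure \<mu> = measure_of UNIV (sets borel) (variation \<mu>)"

lemma sets_variation_measure [simp, measurable_cong]:
  "sets (variation_measure \<mu>) = sets borel"
  and space_variation_measure [simp]: "space (variation_measure \<mu>) = UNIV"
  unfolding variation_measure_def
  using sets.sigma_sets_eq[of borel] by (simp_all add: sets_measure_of_conv space_measure_of_conv)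

lemma variation_upper:
  assumes "range A \<subseteq> sets borel" "disjoint_family A" "(\<Union>n. A n) = E"
  shows "(\<Sum>n. ennreal (cmod (\<mu> (A n)))) \<le> variation \<mu> E"
  unfolding variation_def using assms by (intro SUP_upper) auto

lemma vector_measure_empty:
  fixes \<mu> :: "'g::topological_space set \<Rightarrow> complex"
  assumes "vector_measure \<mu>"
  shows "\<mu> {} = 0"
proof -
  have "(\<lambda>n::nat. \<mu> {}) sums \<mu> {}"
    using assms unfolding vector_measure_def
    by (elim allE[of _ "\<lambda>n::nat. {}"]) (auto simp: disjoint_family_on_def)
  then have "(\<lambda>n::nat. \<mu> {}) \<longlonglongrightarrow> 0"
    by (intro summable_LIMSEQ_zero sums_summable)
  then show ?thesis by (simp add: LIMSEQ_const_iff)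
qed

lemma variation_countably_superadditive:
  fixes \<mu> :: "'g::topological_space set \<Rightarrow> complex"
  assumes E: "range E \<subseteq> sets borel" "disjoint_family E"
  shows "(\<Sum>n. variation \<mu> (E n)) \<le> variation \<mu> (\<Union>n::nat. E n)"
proof -
  define P where "P n = {A :: nat \<Rightarrow> 'g set. range A \<subseteq> sets borel \<and> disjoint_family A \<and> (\<Union>i. A i) = E n}" for n
  have V: "variation \<mu> (E n) = (SUP A \<in> P n. \<Sum>i. ennreal (cmod (\<mu> (A i))))" for n
    unfolding variation_def P_def ..
  have ne: "P n \<noteq> {}" for n
  proof -
    have "(\<lambda>i. if i = 0 then E n else {}) \<in> P n"
      using E(1) by (auto simp: P_def disjoint_family_on_def split: if_splits)
    then show ?thesis by blast
  qed
  have key: "(\<Sum>n. \<Sum>i. ennreal (cmod (\<mu> (A n i)))) \<le> variation \<mu> (\<Union>n. E n)"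
    if A: "\<And>n. A n \<in> P n" for A
  proof -
    define f where "f = (\<lambda>(n, i). ennreal (cmod (\<mu> (A n i))))"
    define B where "B k = A (fst (prod_decode k)) (snd (prod_decode k))" for k
    have "(\<Sum>k. f (prod_decode k)) = (\<Sum>n. \<Sum>i. f (n, i))"
      by (rule suminf_ennreal_2dimen) (rule refl)
    then have sum_B: "(\<Sum>k. ennreal (cmod (\<mu> (B k)))) = (\<Sum>n. \<Sum>i. ennreal (cmod (\<mu> (A n i))))"
      by (simp only: f_def B_def case_prod_unfold fst_conv snd_conv)
    have B_disj: "disjoint_family B"
    proof (unfold disjoint_family_on_def, intro ballI impI)
      fix k l :: nat assume kl: "k \<noteq> l"
      obtain n i where k: "prod_decode k = (n, i)" by fastforce
      obtain n' i' where l: "prod_decode l = (n', i')" by fastforce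
      have neq: "n \<noteq> n' \<or> i \<noteq> i'"
        using kl k l by (metis prod_decode_inverse)
      show "B k \<inter> B l = {}"
      proof (cases "n = n'")
        case True
        then show ?thesis using A[of n] neq k l by (auto simp: P_def B_def disjoint_family_on_def)
      next
        case False
        then have "E n \<inter> E n' = {}" using E(2) by (auto simp: disjoint_family_on_def)
        moreover have "A n i \<subseteq> E n" "A n' i' \<subseteq> E n'" using A by (auto simp: P_def)
        ultimately show ?thesis using k l by (auto simp: B_def)
      qed
    qed
    have B_borel: "range B \<subseteq> sets borel"
      using A by (intro image_subsetI) (auto simp: P_def B_def dest: range_subsetD)
    have B_Un: "(\<Union>k. B k) = (\<Union>n. E n)"
    proof -
      have "A n i \<subseteq> (\<Union>k. B k)" for n i
        using UN_upper[of "prod_encode (n, i)" UNIV B] by (simp add: B_def)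
      moreover have "B k \<subseteq> (\<Union>n. \<Union>i. A n i)" for k by (auto simp: B_def)
      ultimately have "(\<Union>k. B k) = (\<Union>n. \<Union>i. A n i)"
        by (intro antisym UN_least)
      also have "\<dots> = (\<Union>n. E n)" using A by (simp add: P_def)
      finally show ?thesis .
    qed
    show ?thesis unfolding sum_B[symmetric] by (rule variation_upper[OF B_borel B_disj B_Un])
  qed
  show ?thesis
  proof (cases "\<exists>n. variation \<mu> (E n) = top")
    case True
    then obtain n where n: "variation \<mu> (E n) = top" by auto
    have "c \<le> variation \<mu> (\<Union>n. E n)" if "c < top" for c
    proof -
      have "c < (SUP B \<in> P n. \<Sum>i. ennreal (cmod (\<mu> (B i))))"
        using that unfolding V[of n, symmetric] n .
      then obtain B where B: "B \<in> P n" "c < (\<Sum>i. ennreal (cmod (\<mu> (B i))))"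
        unfolding less_SUP_iff by blast
      have "\<forall>n. \<exists>C. C \<in> P n" using ne by blast
      then obtain C where C: "\<And>n. C n \<in> P n" by metis
      let ?A = "C(n := B)"
      have "c \<le> (\<Sum>i. ennreal (cmod (\<mu> (?A n i))))" using B by simp
      also have "\<dots> = (\<Sum>k\<in>{n}. (\<Sum>i. ennreal (cmod (\<mu> (?A k i)))))" by simp
      also have "\<dots> \<le> (\<Sum>k. (\<Sum>i. ennreal (cmod (\<mu> (?A k i)))))"
        by (intro sum_le_suminf) auto
      also have "\<dots> \<le> variation \<mu> (\<Union>n. E n)" using B C by (intro key) auto
      finally show ?thesis .
    qed
    then have "top \<le> variation \<mu> (\<Union>n. E n)" by (rule dense_le)
    then show ?thesis by (rule order_trans[OF top_greatest])
  next
    case False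
    show ?thesis
    proof (rule ennreal_le_epsilon)
      fix e :: real assume "0 < e"
      define d where "d n = ennreal (e * (1/2) ^ Suc n)" for n
      have "\<exists>B \<in> P n. variation \<mu> (E n) \<le> (\<Sum>i. ennreal (cmod (\<mu> (B i)))) + d n" for n
      proof (rule ccontr)
        assume "\<not> ?thesis"
        then have *: "(\<Sum>i. ennreal (cmod (\<mu> (B i)))) + d n \<le> variation \<mu> (E n)" if "B \<in> P n" for B
          using that by (auto simp: not_le intro: less_imp_le)
        have "variation \<mu> (E n) + d n = (SUP B \<in> P n. (\<Sum>i. ennreal (cmod (\<mu> (B i)))) + d n)"
          unfolding V using ne by (simp add: ennreal_SUP_add_left)
        also have "\<dots> \<le> variation \<mu> (E n)" using * by (intro SUP_least)
        finally have "variation \<mu> (E n) + d n \<le> variation \<mu> (E n) + 0" by simp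
        then have "d n = 0" using False unfolding ennreal_add_left_cancel_le by simp
        moreover have "0 < e * (1/2) ^ Suc n" using \<open>0 < e\<close> by simp
        ultimately show False unfolding d_def ennreal_eq_0_iff by linarith
      qed
      then obtain A where A: "\<And>n. A n \<in> P n"
        and le: "\<And>n. variation \<mu> (E n) \<le> (\<Sum>i. ennreal (cmod (\<mu> (A n i)))) + d n" by metis
      have "(\<Sum>n. variation \<mu> (E n)) \<le> (\<Sum>n. (\<Sum>i. ennreal (cmod (\<mu> (A n i)))) + d n)"
        by (intro suminf_le le) auto
      also have "\<dots> = (\<Sum>n. \<Sum>i. ennreal (cmod (\<mu> (A n i)))) + (\<Sum>n. d n)"
        by (rule suminf_add[symmetric]) auto
      also have "(\<Sum>n. d n) = ennreal e"
      proof -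
        have "(\<lambda>n. e * (1/2) ^ Suc n) sums (e * 1)" by (intro sums_mult power_half_series)
        then show ?thesis using \<open>0 < e\<close> unfolding d_def
          by (subst suminf_ennreal2) (auto simp: sums_iff)
      qed
      also have "(\<Sum>n. \<Sum>i. ennreal (cmod (\<mu> (A n i)))) \<le> variation \<mu> (\<Union>n. E n)" by (rule key[OF A])
      finally show "(\<Sum>n. variation \<mu> (E n)) \<le> variation \<mu> (\<Union>n. E n) + ennreal e"
        by (simp add: add_right_mono)
    qed
  qed
qed

text \<open>\<open>measure_of\<close> yields the zero measure if its argument is not a measure; for the variation of
  a complex measure this does not occur.\<close>

lemma emeasure_variation_measure:
  fixes \<mu> :: "'g::topological_space set \<Rightarrow> complex"
  assumes \<mu>: "vector_measure \<mu>" and "E \<in> sets borel"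
  shows "emeasure (variation_measure \<mu>) E = variation \<mu> E"
proof -
  have 0: "variation \<mu> {} = 0"
  proof -
    have "variation \<mu> {} \<le> 0"
      unfolding variation_def by (intro SUP_least) (auto simp: vector_measure_empty[OF \<mu>])
    then show ?thesis by simp
  qed
  have sub: "variation \<mu> (\<Union>n. F n) \<le> (\<Sum>n. variation \<mu> (F n))"
    if F: "range F \<subseteq> sets borel" "disjoint_family F" for F :: "nat \<Rightarrow> 'g set"
  proof (unfold variation_def[of _ "\<Union>n. F n"], rule SUP_least, safe)
    fix A :: "nat \<Rightarrow> 'g set"
    assume A: "range A \<subseteq> sets borel" "disjoint_family A" "(\<Union>i. A i) = (\<Union>n. F n)"
    have "ennreal (cmod (\<mu> (A i))) \<le> (\<Sum>n. ennreal (cmod (\<mu> (A i \<inter> F n))))" for i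
    proof -
      have "range (\<lambda>n. A i \<inter> F n) \<subseteq> sets borel"
        using A(1) F(1) by (intro image_subsetI sets.Int) (auto dest: range_subsetD)
      moreover have "disjoint_family (\<lambda>n. A i \<inter> F n)"
        using F(2) by (auto simp: disjoint_family_on_def)
      ultimately have "(\<lambda>n. \<mu> (A i \<inter> F n)) sums \<mu> (\<Union>n. A i \<inter> F n)"
        using \<mu> unfolding vector_measure_def by blast
      moreover have "(\<Union>n. A i \<inter> F n) = A i" using A(3) by auto
      ultimately have s: "(\<lambda>n. \<mu> (A i \<inter> F n)) sums \<mu> (A i)" by simp
      show ?thesis
      proof (cases "summable (\<lambda>n. cmod (\<mu> (A i \<inter> F n)))")
        case True
        then have "cmod (\<mu> (A i)) \<le> (\<Sum>n. cmod (\<mu> (A i \<inter> F n)))"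
          using summable_norm[OF True] s by (simp add: sums_iff)
        then show ?thesis using True by (subst suminf_ennreal2) (auto intro: ennreal_leI)
      next
        case False
        then have "(\<Sum>n. ennreal (cmod (\<mu> (A i \<inter> F n)))) = top"
          using summable_suminf_not_top[of "\<lambda>n. cmod (\<mu> (A i \<inter> F n))"] norm_ge_zero by blast
        then show ?thesis by simp
      qed
    qed
    then have "(\<Sum>i. ennreal (cmod (\<mu> (A i)))) \<le> (\<Sum>i. \<Sum>n. ennreal (cmod (\<mu> (A i \<inter> F n))))"
      by (intro suminf_le) auto
    also have "\<dots> = (\<Sum>n. \<Sum>i. ennreal (cmod (\<mu> (A i \<inter> F n))))"
    proof -
      have "(\<Sum>i. \<Sum>n. ennreal (cmod (\<mu> (A i \<inter> F n)))) = (\<integral>\<^sup>+ i. (\<Sum>n. ennreal (cmod (\<mu> (A i \<inter> F n)))) \<partial>count_space UNIV)"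
        by (rule nn_integral_count_space_nat[symmetric])
      also have "\<dots> = (\<Sum>n. \<integral>\<^sup>+ i. ennreal (cmod (\<mu> (A i \<inter> F n))) \<partial>count_space UNIV)"
        by (rule nn_integral_suminf) simp
      finally show ?thesis by (simp only: nn_integral_count_space_nat)
    qed
    also have "\<dots> \<le> (\<Sum>n. variation \<mu> (F n))"
    proof (intro suminf_le variation_upper)
      fix n
      show "range (\<lambda>i. A i \<inter> F n) \<subseteq> sets borel"
        using A(1) F(1) by (intro image_subsetI sets.Int) (auto dest: range_subsetD)
      show "disjoint_family (\<lambda>i. A i \<inter> F n)" using A(2) by (auto simp: disjoint_family_on_def)
      show "(\<Union>i. A i \<inter> F n) = F n" using A(3) by auto
    qed auto
    finally show "(\<Sum>i. ennreal (cmod (\<mu> (A i)))) \<le> (\<Sum>n. variation \<mu> (F n))" .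
  qed
  show ?thesis
  proof (rule emeasure_measure_of[OF variation_measure_def])
    show "positive (sets (variation_measure \<mu>)) (variation \<mu>)" by (simp add: positive_def 0)
    show "countably_additive (sets (variation_measure \<mu>)) (variation \<mu>)"
      unfolding countably_additive_def
      by (auto intro!: antisym variation_countably_superadditive sub)
  qed (use assms(2) in auto)
qed


section \<open>Orlicz spaces of a vector measure\<close>

definition young_function :: "(real \<Rightarrow> real) \<Rightarrow> bool" where
  "young_function \<Phi> \<longleftrightarrow>
     (\<forall>t\<ge>0. \<Phi> t \<ge> 0) \<and>
     strict_mono_on {0..} \<Phi> \<and>
     convex_on {0..} \<Phi> \<and>
     continuous_on {0..} \<Phi> \<and>
     (\<forall>t\<ge>0. \<Phi> t = 0 \<longleftrightarrow> t = 0) \<and>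
     filterlim \<Phi> at_top at_top"

text \<open>Norms take values in \<open>[0,\<infinity>]\<close>; the infimum of the empty set is \<open>\<infinity>\<close>.\<close>

definition luxemburg_norm :: "'g measure \<Rightarrow> (real \<Rightarrow> real) \<Rightarrow> ('g \<Rightarrow> complex) \<Rightarrow> ennreal" where
  "luxemburg_norm \<mu> \<Phi> f =
     (INF k \<in> {k::real. k > 0 \<and> (\<integral>\<^sup>+ t. ennreal (\<Phi> (cmod (f t) / k)) \<partial>\<mu>) \<le> 1}. ennreal k)"

definition orlicz_norm ::
    "('g::topological_space set \<Rightarrow> 'x::complex_banach) \<Rightarrow> (real \<Rightarrow> real) \<Rightarrow> ('g \<Rightarrow> complex) \<Rightarrow> ennreal" where
  "orlicz_norm \<nu> \<Phi> f =
     (SUP x' \<in> dual_unit_ball. luxemburg_norm (variation_measure (\<lambda>A. x' (\<nu> A))) \<Phi> f)"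

text \<open>Both spaces are given by their representing functions; membership and norm do not change
  when a Borel function is modified on a \<open>\<nu>\<close>-null Borel set.\<close>

definition weak_orlicz_space ::
    "('g::topological_space set \<Rightarrow> 'x::complex_banach) \<Rightarrow> (real \<Rightarrow> real) \<Rightarrow> ('g \<Rightarrow> complex) set" where
  "weak_orlicz_space \<nu> \<Phi> = {f \<in> borel_measurable borel. orlicz_norm \<nu> \<Phi> f < \<infinity>}"

definition orlicz_space ::
    "('g::topological_space set \<Rightarrow> 'x::complex_banach) \<Rightarrow> (real \<Rightarrow> real) \<Rightarrow> ('g \<Rightarrow> complex) set" where
  "orlicz_space \<nu> \<Phi> =
     {f \<in> weak_orlicz_space \<nu> \<Phi>.
        \<forall>\<epsilon>::real. \<epsilon> > 0 \<longrightarrow> (\<exists>\<phi>. simple_function borel \<phi> \<and> orlicz_norm \<nu> \<Phi> (\<lambda>t. f t - \<phi> t) < ennreal \<epsilon>)}"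

end

theory Submission
  imports Defs
begin

text \<open>
The inequality is Minkowski's: \<open>f * g\<close> is an average of the left translates \<open>\<tau>\<^sub>s g\<close> with total weight
\<open>\<parallel>f\<parallel>\<^sub>1\<close>, and all translates have the same norm. The two halves of this sentence need separate arguments.

Translates have the same norm. Fix \<open>x'\<close> in the dual unit ball and \<open>s\<close>. By the invariance
hypothesis \<open>I\<^sub>\<nu> \<phi> \<mapsto> \<langle>I\<^sub>\<nu> (\<tau>\<^sub>s \<phi>), x'\<rangle>\<close> is a well-defined functional of norm at most 1 on the space of all
\<open>I\<^sub>\<nu> \<phi>\<close>. Its Hahn-Banach extension \<open>y'\<close> satisfies \<open>\<langle>\<nu> A, y'\<rangle> = \<langle>\<nu> (sA), x'\<rangle>\<close>, so the
variation of \<open>\<langle>\<nu>, y'\<rangle>\<close> is the image of that of \<open>\<langle>\<nu>, x'\<rangle>\<close> under translation by \<open>s\<^sup>-\<^sup>1\<close>, and the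
norm of \<open>\<tau>\<^sub>s g\<close> for \<open>x'\<close> is the norm of \<open>g\<close> for \<open>y'\<close> (\<open>translated_functional\<close>,
\<open>orlicz_norm_translate_le\<close>).

Averages do not increase the norm. The group need not be second countable, so \<open>(s, t) \<mapsto> g (s\<^sup>-\<^sup>1 t)\<close> need
not be measurable for the product \<open>\<sigma>\<close>-algebra, and Fubini's theorem does not apply. Instead, for bounded
Borel \<open>f\<close> and \<open>g\<close>, the convolution is an \<open>L\<^sup>1\<close>-limit of finite sums \<open>\<Sum> a\<^sub>i \<tau>\<^bsub>x\<^sub>i\<^esub> g\<close> with
\<open>\<Sum> \<bar>a\<^sub>i\<bar> \<le> \<parallel>f\<parallel>\<^sub>1\<close> (\<open>convolution_approximation_by_translates\<close>). For continuous \<open>g\<close> this is uniform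
continuity; the bounded case follows by approximating \<open>g\<close> by a continuous \<open>c\<close>. Here the approximation is
made in \<open>L\<^sup>1\<close> both of Haar measure and of its image under inversion: the latter controls \<open>f * (g - c)\<close>
uniformly, since \<open>\<integral> \<bar>g - c\<bar> (s\<^sup>-\<^sup>1 t) ds\<close> is the integral of \<open>\<bar>g - c\<bar>\<close> for the inverted measure, and the former
controls the translates. A subsequence converges almost everywhere, and the triangle inequality with
Fatou's lemma gives the norm inequality.

For general \<open>f\<close> and \<open>g\<close> both functions are truncated. At each \<open>t\<close> either \<open>s \<mapsto> f s g (s\<^sup>-\<^sup>1 t)\<close> is
integrable and the truncated convolutions converge to \<open>f * g\<close> at \<open>t\<close>, or \<open>(f * g) t = 0\<close> by
convention; Fatou's lemma applies in either case. Applied to the truncations of \<open>\<bar>f\<bar>\<close> and \<open>\<bar>g\<bar>\<close> the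
inequality shows also that integrability holds for almost all \<open>t\<close>.

If \<open>g\<close> is in the closure of the simple functions, choose \<open>\<phi>\<close> simple and close to \<open>g\<close>. Then \<open>f * g\<close>
is close to \<open>f * \<phi>\<close>, which is bounded, hence a uniform limit of simple functions. Uniform limits are
limits in norm because the variations of all \<open>\<langle>\<nu>, x'\<rangle>\<close> have a common bound (\<open>vector_measure_bounded\<close>).
\<close>

section \<open>The Hahn-Banach theorem\<close>

text \<open>A functional on a subspace is represented by its graph, so extending it means enlarging a subspace of
\<open>'a \<times> \<real>\<close>. The domination \<open>a \<le> norm x\<close> makes such a subspace the graph of a function by itself:
if \<open>(0, a)\<close> belongs to it then so does \<open>(0, - a)\<close>, whence \<open>a = 0\<close>. A union of a chain of dominated
subspaces is again one, so Zorn's lemma gives a maximal one.\<close>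

lemma hahn_banach_graph:
  fixes H0 :: "('a::real_normed_vector \<times> real) set"
  assumes sub: "subspace H0" and dom: "\<And>x a. (x, a) \<in> H0 \<Longrightarrow> a \<le> norm x"
  obtains u :: "'a \<Rightarrow> real"
    where "linear u" "\<And>x. u x \<le> norm x" "\<And>x a. (x, a) \<in> H0 \<Longrightarrow> u x = a"
proof -
  define \<A> where "\<A> = {H. subspace H \<and> H0 \<subseteq> H \<and> (\<forall>x a. (x, a) \<in> H \<longrightarrow> a \<le> norm x)}"
  have "\<exists>M\<in>\<A>. \<forall>X\<in>\<A>. M \<subseteq> X \<longrightarrow> X = M"
  proof (rule subset_Zorn_nonempty)
    show "\<A> \<noteq> {}" using sub dom by (auto simp: \<A>_def)
    fix \<C> assume ne: "\<C> \<noteq> {}" and "subset.chain \<A> \<C>"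
    then have CA: "\<C> \<subseteq> \<A>" and ch: "\<And>S T. S \<in> \<C> \<Longrightarrow> T \<in> \<C> \<Longrightarrow> S \<subseteq> T \<or> T \<subseteq> S"
      by (auto simp: subset.chain_def)
    have "subspace (\<Union>\<C>)"
    proof (rule subspaceI)
      obtain S where "S \<in> \<C>" using ne by blast
      with CA have "0 \<in> S" by (auto simp: \<A>_def intro: subspace_0)
      with \<open>S \<in> \<C>\<close> show "0 \<in> \<Union>\<C>" by blast
      show "x + y \<in> \<Union>\<C>" if xy: "x \<in> \<Union>\<C>" "y \<in> \<Union>\<C>" for x y
      proof -
        obtain S T where "S \<in> \<C>" "x \<in> S" "T \<in> \<C>" "y \<in> T" using xy by blast
        moreover from this obtain R where "R \<in> \<C>" "S \<subseteq> R" "T \<subseteq> R" using ch by blast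
        ultimately have "x + y \<in> R" using CA by (intro subspace_add) (auto simp: \<A>_def)
        with \<open>R \<in> \<C>\<close> show ?thesis by blast
      qed
      show "c *\<^sub>R x \<in> \<Union>\<C>" if "x \<in> \<Union>\<C>" for c x
        using that CA by (auto simp: \<A>_def intro: subspace_scale)
    qed
    then show "\<Union>\<C> \<in> \<A>" using ne CA by (fastforce simp: \<A>_def)
  qed
  then obtain M where M: "M \<in> \<A>" and max: "\<And>X. X \<in> \<A> \<Longrightarrow> M \<subseteq> X \<Longrightarrow> X = M" by blast
  have subM: "subspace M" and H0M: "H0 \<subseteq> M" and domM: "\<And>x a. (x, a) \<in> M \<Longrightarrow> a \<le> norm x"
    using M by (auto simp: \<A>_def)
  have total: "\<exists>c. (x0, c) \<in> M" for x0
  proof -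
    \<comment> \<open>A value \<open>c\<close> at \<open>x0\<close> keeps the domination iff
      \<open>a - norm (y - x0) \<le> c \<le> norm (z + x0) - b\<close> for all points \<open>(y, a)\<close>, \<open>(z, b)\<close> of the graph.\<close>
    let ?L = "(\<lambda>(y, a). a - norm (y - x0)) ` M"
    have sep: "a - norm (y - x0) \<le> norm (z + x0) - b" if "(y, a) \<in> M" "(z, b) \<in> M" for y a z b
    proof -
      have "(y + z, a + b) \<in> M" using subspace_add[OF subM that] by simp
      then have "a + b \<le> norm (y + z)" by (rule domM)
      also have "\<dots> \<le> norm (y - x0) + norm (z + x0)"
        using norm_triangle_ineq[of "y - x0" "z + x0"] by simp
      finally show ?thesis by simp
    qed
    have M0: "(0, 0) \<in> M" using subspace_0[OF subM] by (simp add: zero_prod_def)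
    have bdd: "bdd_above ?L" using sep M0 by (intro bdd_aboveI[of _ "norm x0"]) fastforce
    define c where "c = Sup ?L"
    have low: "a - norm (y - x0) \<le> c" if "(y, a) \<in> M" for y a
      unfolding c_def using that by (intro cSup_upper bdd) force
    have up: "c \<le> norm (z + x0) - b" if "(z, b) \<in> M" for z b
      unfolding c_def using M0 that sep by (intro cSup_least) fastforce+
    let ?M' = "span (insert (x0, c) M)"
    have "a \<le> norm x" if xa: "(x, a) \<in> ?M'" for x a
    proof -
      obtain k where "(x, a) - k *\<^sub>R (x0, c) \<in> span M" using xa span_breakdown_eq by blast
      moreover have "span M = M" using subM by simp
      ultimately have k: "(x - k *\<^sub>R x0, a - k * c) \<in> M" by simp
      consider "k = 0" | "k > 0" | "k < 0" by linarith
      then show ?thesis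
      proof cases
        case 1 then show ?thesis using k domM by simp
      next
        case 2
        have "(1 / k) *\<^sub>R (x - k *\<^sub>R x0, a - k * c) \<in> M" by (rule subspace_scale[OF subM k])
        then have "c \<le> norm ((1/k) *\<^sub>R x) - (a / k - c)"
          using up[of "(1/k) *\<^sub>R (x - k *\<^sub>R x0)" "(1 / k) * (a - k * c)"] 2
          by (simp add: algebra_simps diff_divide_distrib)
        then show ?thesis using 2 by (simp add: field_simps)
      next
        case 3
        have "(- 1 / k) *\<^sub>R (x - k *\<^sub>R x0, a - k * c) \<in> M" by (rule subspace_scale[OF subM k])
        then have "(- a / k + c) - norm ((-1/k) *\<^sub>R x) \<le> c"
          using low[of "(-1/k) *\<^sub>R (x - k *\<^sub>R x0)" "(-1 / k) * (a - k * c)"] 3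
          by (simp add: algebra_simps diff_divide_distrib)
        then show ?thesis using 3 by (simp add: field_simps)
      qed
    qed
    then have "?M' \<in> \<A>" using H0M span_superset[of "insert (x0, c) M"] by (auto simp: \<A>_def)
    then have "?M' = M" using max span_superset[of "insert (x0, c) M"] by blast
    then show ?thesis using span_superset[of "insert (x0, c) M"] by blast
  qed
  have unique: "a = b" if "(x, a) \<in> M" "(x, b) \<in> M" for x a b
  proof -
    have "(0, a - b) \<in> M" "(0, b - a) \<in> M"
      using subspace_diff[OF subM that] subspace_diff[OF subM that(2) that(1)] by auto
    then show ?thesis using domM[of 0 "a - b"] domM[of 0 "b - a"] by simp
  qed
  define u where "u x = (SOME c. (x, c) \<in> M)" for x
  have uM: "(x, u x) \<in> M" for x unfolding u_def using total by (rule someI_ex)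
  show thesis
  proof
    show "linear u"
    proof (rule linearI)
      show "u (x + y) = u x + u y" for x y
        using subspace_add[OF subM uM uM, of x y] uM[of "x + y"] by (intro unique) auto
      show "u (r *\<^sub>R x) = r *\<^sub>R u x" for r x
        using subspace_scale[OF subM uM, of r x] uM[of "r *\<^sub>R x"] by (intro unique) auto
    qed
    show "u x \<le> norm x" for x using uM by (rule domM)
    show "u x = a" if "(x, a) \<in> H0" for x a using that H0M uM[of x] by (intro unique) auto
  qed
qed

lemma scaleC_zero [simp]: "c *\<^sub>C (0::'x::complex_banach) = 0"
  using norm_scaleC[of c "0::'x"] by simp

lemma scaleC_sum: "c *\<^sub>C sum (f :: _ \<Rightarrow> 'x::complex_banach) A = (\<Sum>i\<in>A. c *\<^sub>C f i)"
  by (induction A rule: infinite_finite_induct) (simp_all add: scaleC_add_right)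

lemma scaleR_conv_scaleC: "r *\<^sub>R (x::'x::complex_banach) = complex_of_real r *\<^sub>C x"
  by (simp add: scaleC_of_real)

lemma dual_unit_ballD:
  assumes "x' \<in> dual_unit_ball"
  shows "bounded_linear x'" "x' (c *\<^sub>C x) = c * x' x" "cmod (x' x) \<le> norm x"
proof -
  show b: "bounded_linear x'" and "x' (c *\<^sub>C x) = c * x' x"
    using assms by (auto simp: dual_unit_ball_def dual_space_def)
  have "cmod (x' x) \<le> onorm x' * norm x" by (rule onorm[OF b])
  also have "\<dots> \<le> 1 * norm x"
    using assms by (intro mult_right_mono) (auto simp: dual_unit_ball_def)
  finally show "cmod (x' x) \<le> norm x" by simp
qed

text \<open>The complex theorem follows from the real one for \<open>u = Re \<circ> y'\<close>: a complex linear \<open>y'\<close> is recovered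
as \<open>y' x = u x - \<i> u (\<i> x)\<close>, and rotating \<open>y' x\<close> to the positive half-line bounds its modulus by
that of a value of \<open>u\<close>.\<close>

lemma dual_unit_ball_extension:
  fixes H :: "('x::complex_banach \<times> complex) set"
  assumes zero: "(0, 0) \<in> H"
    and add: "\<And>x a y b. (x, a) \<in> H \<Longrightarrow> (y, b) \<in> H \<Longrightarrow> (x + y, a + b) \<in> H"
    and scale: "\<And>x a c. (x, a) \<in> H \<Longrightarrow> (c *\<^sub>C x, c * a) \<in> H"
    and dom: "\<And>x a. (x, a) \<in> H \<Longrightarrow> cmod a \<le> norm x"
  obtains y' where "y' \<in> dual_unit_ball" "\<And>x a. (x, a) \<in> H \<Longrightarrow> y' x = a"
proof -
  define H0 where "H0 = {(x, Re a) |x a. (x, a) \<in> H}"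
  have "subspace H0"
  proof (rule subspaceI)
    show "0 \<in> H0" using zero by (force simp: H0_def zero_prod_def)
    show "p + q \<in> H0" if "p \<in> H0" "q \<in> H0" for p q
      using that add by (force simp: H0_def)
    show "r *\<^sub>R p \<in> H0" if "p \<in> H0" for r p
      using that scale[of _ _ "complex_of_real r"] by (force simp: H0_def scaleR_conv_scaleC)
  qed
  moreover have "a \<le> norm x" if "(x, a) \<in> H0" for x a
    using that dom complex_Re_le_cmod order_trans by (fastforce simp: H0_def)
  ultimately obtain u where u: "linear u" "\<And>x. u x \<le> norm x" "\<And>x a. (x, a) \<in> H0 \<Longrightarrow> u x = a"
    using hahn_banach_graph by metis
  have uH: "u x = Re a" if "(x, a) \<in> H" for x a
    using that by (intro u(3)) (auto simp: H0_def)
  define y' where "y' x = Complex (u x) (- u (\<i> *\<^sub>C x))" for x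
  have scaleC_eq: "c *\<^sub>C x = Re c *\<^sub>R x + Im c *\<^sub>R (\<i> *\<^sub>C x)" for c and x :: 'x
    unfolding scaleR_conv_scaleC scaleC_scaleC scaleC_add_left[symmetric]
    by (rule arg_cong[of _ _ "\<lambda>c. c *\<^sub>C x"]) (simp add: complex_eq_iff)
  have ii: "\<i> *\<^sub>C \<i> *\<^sub>C x = - x" for x :: 'x
    using scaleC_of_real[of "-1" x] by (simp add: scaleC_scaleC)
  have y'_add: "y' (x + y) = y' x + y' y" for x y
    by (simp add: y'_def scaleC_add_right linear_add[OF u(1)] complex_eq_iff)
  have y'_scaleR: "y' (r *\<^sub>R x) = r *\<^sub>R y' x" for r x
  proof -
    have "\<i> *\<^sub>C r *\<^sub>R x = r *\<^sub>R (\<i> *\<^sub>C x)"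
      unfolding scaleR_conv_scaleC scaleC_scaleC by (simp add: mult.commute)
    then show ?thesis by (simp add: y'_def linear_scale[OF u(1)] complex_eq_iff)
  qed
  have y'_i: "y' (\<i> *\<^sub>C x) = \<i> * y' x" for x
    by (simp add: y'_def ii linear_neg[OF u(1)] complex_eq_iff)
  have y'_scaleC: "y' (c *\<^sub>C x) = c * y' x" for c x
    by (simp add: scaleC_eq[of c] y'_add y'_scaleR y'_i scaleR_conv_of_real complex_eq_iff)
  have le: "cmod (y' x) \<le> norm x" for x
  proof (cases "y' x = 0")
    case False
    define c where "c = cnj (sgn (y' x))"
    have c: "cmod c = 1" using False by (simp add: c_def norm_sgn)
    have "c * y' x = complex_of_real (cmod (y' x))"
      using False complex_norm_square[of "y' x"]
      by (simp add: c_def sgn_eq field_simps power2_eq_square)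
    then have "cmod (y' x) = Re (y' (c *\<^sub>C x))" by (simp add: y'_scaleC)
    also have "\<dots> \<le> norm (c *\<^sub>C x)" by (simp add: y'_def u(2))
    finally show ?thesis by (simp add: norm_scaleC c)
  qed simp
  have "bounded_linear y'"
    by (rule bounded_linear_intro[of _ 1]) (auto simp: y'_add y'_scaleR le)
  moreover have "onorm y' \<le> 1" using le by (intro onorm_bound) auto
  ultimately have "y' \<in> dual_unit_ball"
    using y'_scaleC by (auto simp: dual_unit_ball_def dual_space_def)
  moreover have "y' x = a" if "(x, a) \<in> H" for x a
    using uH[OF that] uH[OF scale[OF that, of \<i>]] by (simp add: y'_def complex_eq_iff)
  ultimately show thesis using that by blast
qed

section \<open>Integration of simple functions\<close>

lemma normed_vector_measure_empty:
  assumes "vector_measure \<nu>"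
  shows "\<nu> {} = 0"
proof -
  have "(\<lambda>n::nat. \<nu> {}) sums \<nu> {}"
    using assms unfolding vector_measure_def
    by (elim allE[of _ "\<lambda>n::nat. {}"]) (auto simp: disjoint_family_on_def)
  then have "(\<lambda>n::nat. \<nu> {}) \<longlonglongrightarrow> 0"
    by (intro summable_LIMSEQ_zero sums_summable)
  then show ?thesis by (simp add: LIMSEQ_const_iff)
qed

lemma vector_measure_Un:
  assumes \<nu>: "vector_measure \<nu>" and AB: "A \<in> sets borel" "B \<in> sets borel" "A \<inter> B = {}"
  shows "\<nu> (A \<union> B) = \<nu> A + \<nu> B"
proof -
  define F where "F = (\<lambda>n::nat. if n = 0 then A else if n = 1 then B else {})"
  have "range F \<subseteq> sets borel" "disjoint_family F" "(\<Union>n. F n) = A \<union> B"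
    using AB by (auto simp: F_def disjoint_family_on_def split: if_splits)
  then have "(\<lambda>n. \<nu> (F n)) sums \<nu> (A \<union> B)"
    using \<nu> unfolding vector_measure_def by metis
  moreover have "(\<lambda>n. \<nu> (F n)) sums (\<Sum>n\<in>{0,1}. \<nu> (F n))"
    by (rule sums_finite) (auto simp: F_def normed_vector_measure_empty[OF \<nu>])
  ultimately show ?thesis by (simp add: F_def sums_iff)
qed

lemma vector_measure_UN:
  assumes \<nu>: "vector_measure \<nu>" and "finite I"
    and "\<And>i. i \<in> I \<Longrightarrow> A i \<in> sets borel" "disjoint_family_on A I"
  shows "\<nu> (\<Union>i\<in>I. A i) = (\<Sum>i\<in>I. \<nu> (A i))"
  using assms(2-)
proof (induction I rule: finite_induct)
  case (insert i I)
  have "\<nu> (A i \<union> (\<Union>i\<in>I. A i)) = \<nu> (A i) + \<nu> (\<Union>i\<in>I. A i)"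
    using insert by (intro vector_measure_Un[OF \<nu>] sets.finite_UN)
       (auto simp: disjoint_family_on_def)
  then show ?case using insert by (simp add: disjoint_family_on_mono[OF subset_insertI])
qed (simp add: normed_vector_measure_empty[OF \<nu>])

text \<open>The integral may be computed on any finite Borel partition on whose parts the function is constant.
With \<open>Z = (\<phi>, \<psi>)\<close> this puts two simple functions on a common partition, which makes additivity a
statement about finite sums.\<close>

lemma simple_vector_integral_compose:
  assumes \<nu>: "vector_measure \<nu>" and R: "finite R" "range Z \<subseteq> R"
    and Z: "\<And>z. z \<in> R \<Longrightarrow> Z -` {z} \<in> sets borel"
  shows "simple_vector_integral \<nu> (\<lambda>t. h (Z t)) = (\<Sum>z\<in>R. h z *\<^sub>C \<nu> (Z -` {z}))"
proof -
  have fin: "finite (range Z)" using R finite_subset by blast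
  have "simple_vector_integral \<nu> (\<lambda>t. h (Z t))
      = (\<Sum>y\<in>h ` range Z. y *\<^sub>C \<nu> (\<Union>z\<in>{z \<in> range Z. h z = y}. Z -` {z}))"
    unfolding simple_vector_integral_def
    by (intro sum.cong arg_cong2[of _ _ _ _ "(*\<^sub>C)"] arg_cong[of _ _ \<nu>]) (auto simp: image_image)
  also have "\<dots> = (\<Sum>y\<in>h ` range Z. \<Sum>z\<in>{z \<in> range Z. h z = y}. h z *\<^sub>C \<nu> (Z -` {z}))"
  proof (rule sum.cong[OF refl])
    fix y
    have "\<nu> (\<Union>z\<in>{z \<in> range Z. h z = y}. Z -` {z}) = (\<Sum>z\<in>{z \<in> range Z. h z = y}. \<nu> (Z -` {z}))"
      using fin R Z by (intro vector_measure_UN[OF \<nu>]) (auto simp: disjoint_family_on_def)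
    then show "y *\<^sub>C \<nu> (\<Union>z\<in>{z \<in> range Z. h z = y}. Z -` {z})
        = (\<Sum>z\<in>{z \<in> range Z. h z = y}. h z *\<^sub>C \<nu> (Z -` {z}))"
      by (simp add: scaleC_sum)
  qed
  also have "\<dots> = (\<Sum>z\<in>range Z. h z *\<^sub>C \<nu> (Z -` {z}))"
    by (rule sum.image_gen[OF fin, symmetric])
  also have "\<dots> = (\<Sum>z\<in>R. h z *\<^sub>C \<nu> (Z -` {z}))"
  proof (rule sum.mono_neutral_left[OF R], intro ballI)
    fix z assume "z \<in> R - range Z"
    then have "Z -` {z} = {}" by auto
    then show "h z *\<^sub>C \<nu> (Z -` {z}) = 0" by (simp only: normed_vector_measure_empty[OF \<nu>] scaleC_zero)
  qed
  finally show ?thesis .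
qed

lemma simple_function_borelD:
  assumes "simple_function borel \<phi>"
  shows "finite (range \<phi>)" "\<phi> -` {z} \<in> sets borel"
  using assms simple_functionD[OF assms] by auto

lemma simple_vector_integral_add:
  assumes \<nu>: "vector_measure \<nu>" and \<phi>: "simple_function borel \<phi>" and \<psi>: "simple_function borel \<psi>"
  shows "simple_vector_integral \<nu> (\<lambda>t. \<phi> t + \<psi> t)
    = simple_vector_integral \<nu> \<phi> + simple_vector_integral \<nu> \<psi>"
proof -
  let ?Z = "\<lambda>t. (\<phi> t, \<psi> t)" and ?R = "range \<phi> \<times> range \<psi>"
  have Z: "?Z -` {z} \<in> sets borel" for z
  proof -
    have "?Z -` {z} = \<phi> -` {fst z} \<inter> \<psi> -` {snd z}" by auto
    then show ?thesis using \<phi> \<psi> by (simp add: simple_function_borelD sets.Int)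
  qed
  have I: "simple_vector_integral \<nu> (\<lambda>t. h (?Z t)) = (\<Sum>z\<in>?R. h z *\<^sub>C \<nu> (?Z -` {z}))" for h
    using \<phi> \<psi> Z by (intro simple_vector_integral_compose[OF \<nu>]) (auto intro: simple_function_borelD)
  show ?thesis
    using I[of "\<lambda>z. fst z + snd z"] I[of fst] I[of snd]
    by (simp add: scaleC_add_left sum.distrib)
qed

lemma simple_vector_integral_scale:
  assumes \<nu>: "vector_measure \<nu>" and \<phi>: "simple_function borel \<phi>"
  shows "simple_vector_integral \<nu> (\<lambda>t. c * \<phi> t) = c *\<^sub>C simple_vector_integral \<nu> \<phi>"
proof -
  have "simple_vector_integral \<nu> (\<lambda>t. c * \<phi> t) = (\<Sum>z\<in>range \<phi>. (c * z) *\<^sub>C \<nu> (\<phi> -` {z}))"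
    using \<phi> by (intro simple_vector_integral_compose[OF \<nu>]) (auto intro: simple_function_borelD)
  then show ?thesis by (simp add: simple_vector_integral_def scaleC_sum scaleC_scaleC)
qed

lemma simple_vector_integral_indicator:
  assumes \<nu>: "vector_measure \<nu>" and A: "A \<in> sets borel"
  shows "simple_vector_integral \<nu> (\<lambda>t. indicator A t) = \<nu> A"
proof -
  have "simple_vector_integral \<nu> (\<lambda>t. of_bool (t \<in> A))
      = (\<Sum>z\<in>UNIV. of_bool z *\<^sub>C \<nu> ((\<lambda>t. t \<in> A) -` {z}))"
  proof (rule simple_vector_integral_compose[OF \<nu>])
    show "(\<lambda>t. t \<in> A) -` {z} \<in> sets borel" for z
      using A by (cases z) (auto simp: vimage_def Compl_eq[symmetric])
  qed auto
  also have "\<dots> = \<nu> A"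
    using scaleC_of_real[of 1 "\<nu> A"] scaleC_of_real[of 0 "\<nu> {x. x \<notin> A}"]
    by (simp add: UNIV_bool vimage_def)
  also have "(\<lambda>t. of_bool (t \<in> A)) = (\<lambda>t. indicator A t :: complex)" by (auto simp: indicator_def)
  finally show ?thesis .
qed

section \<open>Translation invariance of the norm\<close>

lemma measurable_translation [measurable]:
  fixes s :: "'g::topological_group_add"
  shows "(\<lambda>t. s + t) \<in> borel_measurable borel"
    "(\<lambda>t. - t + s) \<in> borel_measurable borel" "uminus \<in> borel_measurable (borel :: 'g measure)"
  by (intro borel_measurable_continuous_onI continuous_intros)+

lemma translation_image: "(+) s ` A = (\<lambda>t. - s + t) -` (A :: 'g::group_add set)"
  by (auto simp: image_iff add.assoc[symmetric] intro!: bexI[of _ "- s + _"])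

lemma sets_translation_image:
  fixes s :: "'g::topological_group_add"
  assumes "A \<in> sets borel"
  shows "(+) s ` A \<in> sets borel"
  using measurable_sets[OF measurable_translation(1)[of "- s"] assms] by (simp add: translation_image)

lemma simple_function_translate:
  fixes \<phi> :: "'g::topological_group_add \<Rightarrow> complex"
  assumes "simple_function borel \<phi>"
  shows "simple_function borel (translate s \<phi>)"
  unfolding translate_def
  by (rule simple_function_comp[OF measurable_translation(1) assms, unfolded comp_def space_borel])

text \<open>Invariance makes \<open>H\<close>, the set of all pairs \<open>(I\<^sub>\<nu> \<phi>, x' (I\<^sub>\<nu> (\<tau>\<^sub>s \<phi>)))\<close>, a dominated graph, and an
extension of it is the required functional. Without Hahn-Banach there would be no functional on the
whole space to compare with in the supremum that defines the norm.\<close>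

lemma translated_functional:
  fixes \<nu> :: "'g::topological_group_add set \<Rightarrow> 'x::complex_banach"
  assumes \<nu>: "vector_measure \<nu>" and inv: "norm_integral_translation_invariant \<nu>"
    and x': "x' \<in> dual_unit_ball"
  obtains y' where "y' \<in> dual_unit_ball" "\<And>A. A \<in> sets borel \<Longrightarrow> y' (\<nu> A) = x' (\<nu> ((+) s ` A))"
proof -
  let ?I = "simple_vector_integral \<nu>"
  define H where "H = {(?I \<phi>, x' (?I (translate s \<phi>))) |\<phi>. simple_function borel \<phi>}"
  have HI: "(?I \<phi>, x' (?I (translate s \<phi>))) \<in> H" if "simple_function borel \<phi>" for \<phi>
    using that by (auto simp: H_def)
  note lin = dual_unit_ballD[OF x']
  have scale: "(c *\<^sub>C x, c * a) \<in> H" if "(x, a) \<in> H" for c x a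
  proof -
    from that obtain \<phi> where \<phi>: "simple_function borel \<phi>" "x = ?I \<phi>" "a = x' (?I (translate s \<phi>))"
      by (auto simp: H_def)
    have "simple_function borel (\<lambda>t. c * \<phi> t)" using \<phi>(1) by (rule simple_function_compose1)
    moreover have "translate s (\<lambda>t. c * \<phi> t) = (\<lambda>t. c * translate s \<phi> t)" by (simp add: translate_def)
    ultimately show ?thesis
      using HI[of "\<lambda>t. c * \<phi> t"] \<phi>(1)
      by (simp add: \<phi>(2,3) simple_vector_integral_scale[OF \<nu>] simple_function_translate lin(2))
  qed
  have add: "(x + y, a + b) \<in> H" if "(x, a) \<in> H" "(y, b) \<in> H" for x a y b
  proof -
    from that obtain \<phi> \<psi> where \<phi>: "simple_function borel \<phi>" "x = ?I \<phi>" "a = x' (?I (translate s \<phi>))"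
      and \<psi>: "simple_function borel \<psi>" "y = ?I \<psi>" "b = x' (?I (translate s \<psi>))"
      by (auto simp: H_def)
    have "simple_function borel (\<lambda>t. \<phi> t + \<psi> t)" using \<phi>(1) \<psi>(1) by (rule simple_function_add)
    moreover have "translate s (\<lambda>t. \<phi> t + \<psi> t) = (\<lambda>t. translate s \<phi> t + translate s \<psi> t)"
      by (simp add: translate_def)
    ultimately show ?thesis
      using HI[of "\<lambda>t. \<phi> t + \<psi> t"] \<phi>(1) \<psi>(1)
      by (simp add: \<phi>(2,3) \<psi>(2,3) simple_vector_integral_add[OF \<nu>] simple_function_translate
            linear_add[OF bounded_linear.linear[OF lin(1)]])
  qed
  have dom: "cmod a \<le> norm x" if "(x, a) \<in> H" for x a
  proof -
    from that obtain \<phi> where \<phi>: "simple_function borel \<phi>" "x = ?I \<phi>" "a = x' (?I (translate s \<phi>))"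
      by (auto simp: H_def)
    have "cmod a \<le> norm (?I (translate s \<phi>))" unfolding \<phi>(3) by (rule lin(3))
    also have "\<dots> = norm x" unfolding \<phi>(2)
      using inv \<phi>(1) by (simp add: norm_integral_translation_invariant_def)
    finally show ?thesis .
  qed
  have zero: "(0, 0) \<in> H"
  proof -
    have "scaleC 0 (?I (\<lambda>t. 0)) = 0" using scaleC_of_real[of 0] by simp
    with scale[OF HI[of "\<lambda>t. 0"], of 0] show ?thesis by simp
  qed
  obtain y' where y': "y' \<in> dual_unit_ball" "\<And>x a. (x, a) \<in> H \<Longrightarrow> y' x = a"
    using dual_unit_ball_extension[OF zero add scale dom] by metis
  show thesis
  proof (rule that[OF y'(1)])
    fix A :: "'g set" assume A: "A \<in> sets borel"
    have "translate s (\<lambda>t. indicator A t) = (\<lambda>t. indicator ((+) s ` A) t :: complex)"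
      unfolding translation_image by (auto simp: translate_def indicator_def)
    then show "y' (\<nu> A) = x' (\<nu> ((+) s ` A))"
      using y'(2)[OF HI, of "\<lambda>t. indicator A t"] A
      by (simp add: simple_vector_integral_indicator[OF \<nu>] sets_translation_image)
  qed
qed

lemma variation_cong:
  assumes "\<And>A. A \<in> sets borel \<Longrightarrow> \<mu> A = \<mu>' A"
  shows "variation \<mu> E = variation \<mu>' E"
  unfolding variation_def using assms
  by (intro SUP_cong refl suminf_cong arg_cong[of _ _ ennreal] arg_cong[of _ _ cmod]) (auto simp: image_subset_iff)

text \<open>Translation maps the countable Borel partitions of \<open>E\<close> bijectively to those of \<open>s + E\<close>; one
inequality gives the other when applied to \<open>- s\<close>.\<close>

lemma variation_translation:
  fixes s :: "'g::topological_group_add"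
  shows "variation (\<lambda>A. \<mu> ((+) s ` A)) E = variation \<mu> ((+) s ` E)"
proof -
  have le: "variation (\<lambda>A. \<mu> ((+) s ` A)) E \<le> variation \<mu> ((+) s ` E)"
    for \<mu> :: "'g set \<Rightarrow> complex" and s E
    unfolding variation_def[of _ E]
  proof (rule SUP_least, clarify)
    fix A :: "nat \<Rightarrow> 'g set" assume A: "range A \<subseteq> sets borel" "disjoint_family A" "E = (\<Union>n. A n)"
    have "disjoint_family (\<lambda>n. (+) s ` A n)"
      using A(2) by (simp add: disjoint_family_on_def image_Int[symmetric])
    then show "(\<Sum>n. ennreal (cmod (\<mu> ((+) s ` A n)))) \<le> variation \<mu> ((+) s ` (\<Union>n. A n))"
      using A(1) by (intro variation_upper) (auto simp: sets_translation_image)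
  qed
  have cancel: "(+) s ` (+) (- s) ` A = A" "(+) (- s) ` (+) s ` A = A" for A
    by (auto simp: image_image add.assoc[symmetric])
  show ?thesis
    using le[of \<mu> s E] le[of "\<lambda>A. \<mu> ((+) s ` A)" "- s" "(+) s ` E"] by (simp add: cancel)
qed

lemma vector_measure_functional:
  assumes "vector_measure \<nu>" "x' \<in> dual_unit_ball"
  shows "vector_measure (\<lambda>A. x' (\<nu> A))"
  using assms bounded_linear.sums[OF dual_unit_ballD(1)[OF assms(2)]]
  unfolding vector_measure_def by blast

lemma variation_measure_translated_functional:
  fixes \<nu> :: "'g::topological_group_add set \<Rightarrow> 'x::complex_banach"
  assumes \<nu>: "vector_measure \<nu>" and x': "x' \<in> dual_unit_ball" and y': "y' \<in> dual_unit_ball"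
    and eq: "\<And>A. A \<in> sets borel \<Longrightarrow> y' (\<nu> A) = x' (\<nu> ((+) s ` A))"
  shows "variation_measure (\<lambda>A. y' (\<nu> A))
    = distr (variation_measure (\<lambda>A. x' (\<nu> A))) borel (\<lambda>t. - s + t)"
proof (rule measure_eqI)
  fix E assume "E \<in> sets (variation_measure (\<lambda>A. y' (\<nu> A)))"
  then have E: "E \<in> sets borel" by simp
  have "emeasure (variation_measure (\<lambda>A. y' (\<nu> A))) E = variation (\<lambda>A. x' (\<nu> ((+) s ` A))) E"
    using vector_measure_functional[OF \<nu> y'] E eq
    by (simp add: emeasure_variation_measure cong: variation_cong)
  also have "\<dots> = emeasure (variation_measure (\<lambda>A. x' (\<nu> A))) ((+) s ` E)"
    using vector_measure_functional[OF \<nu> x'] E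
    by (simp add: emeasure_variation_measure sets_translation_image variation_translation[of "\<lambda>A. x' (\<nu> A)"])
  also have "\<dots> = emeasure (distr (variation_measure (\<lambda>A. x' (\<nu> A))) borel (\<lambda>t. - s + t)) E"
    using E by (subst emeasure_distr) (auto simp: translation_image cong: measurable_cong_sets)
  finally show "emeasure (variation_measure (\<lambda>A. y' (\<nu> A))) E
    = emeasure (distr (variation_measure (\<lambda>A. x' (\<nu> A))) borel (\<lambda>t. - s + t)) E" .
qed simp

section \<open>The Luxemburg norm\<close>

lemma young_functionD:
  assumes "young_function \<Phi>"
  shows young_nonneg: "t \<ge> 0 \<Longrightarrow> \<Phi> t \<ge> 0"
    and young_mono: "0 \<le> s \<Longrightarrow> s \<le> t \<Longrightarrow> \<Phi> s \<le> \<Phi> t"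
    and young_zero: "\<Phi> 0 = 0"
    and young_convex: "convex_on {0..} \<Phi>"
    and young_continuous: "continuous_on {0..} \<Phi>"
    and young_at_top: "filterlim \<Phi> at_top at_top"
proof -
  note \<Phi> = assms[unfolded young_function_def]
  show "t \<ge> 0 \<Longrightarrow> \<Phi> t \<ge> 0" using \<Phi> by blast
  show "\<Phi> s \<le> \<Phi> t" if "0 \<le> s" "s \<le> t"
    by (rule strict_mono_on_leD[of "{0..}"]) (use \<Phi> that in auto)
  show "\<Phi> 0 = 0" using \<Phi> by blast
  show "convex_on {0..} \<Phi>" "continuous_on {0..} \<Phi>" "filterlim \<Phi> at_top at_top" using \<Phi> by auto
qed

text \<open>Nothing is known about \<open>\<Phi>\<close> on the negative reals, so measurability is derived from that of
\<open>x \<mapsto> \<Phi> (max 0 x)\<close>, which is continuous everywhere.\<close>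

lemma young_measurable:
  fixes h :: "'a \<Rightarrow> complex"
  assumes "young_function \<Phi>" "k \<ge> 0" and [measurable]: "h \<in> borel_measurable M"
  shows "(\<lambda>t. ennreal (\<Phi> (cmod (h t) / k))) \<in> borel_measurable M"
proof -
  have "continuous_on UNIV (\<lambda>x::real. \<Phi> (max 0 x))"
    by (rule continuous_on_compose2[OF young_continuous[OF assms(1)]]) (auto intro!: continuous_intros)
  then have [measurable]: "(\<lambda>x::real. \<Phi> (max 0 x)) \<in> borel_measurable borel"
    by (rule borel_measurable_continuous_onI)
  have "(\<lambda>t. ennreal (\<Phi> (max 0 (cmod (h t) / k)))) \<in> borel_measurable M" by measurable
  then show ?thesis using assms(2) by simp
qed

lemma luxemburg_le:
  "k > 0 \<Longrightarrow> (\<integral>\<^sup>+ t. ennreal (\<Phi> (cmod (h t) / k)) \<partial>\<mu>) \<le> 1 \<Longrightarrow> luxemburg_norm \<mu> \<Phi> h \<le> ennreal k"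
  unfolding luxemburg_norm_def by (intro INF_lower) auto

text \<open>Together with \<open>luxemburg_leI\<close> this allows arguments with scales \<open>k\<close> strictly above the norm, so that
it does not matter whether the infimum is attained.\<close>

lemma luxemburg_lessD:
  assumes \<Phi>: "young_function \<Phi>" and less: "luxemburg_norm \<mu> \<Phi> h < ennreal k"
  shows "(\<integral>\<^sup>+ t. ennreal (\<Phi> (cmod (h t) / k)) \<partial>\<mu>) \<le> 1"
proof -
  obtain l where l: "l > 0" "(\<integral>\<^sup>+ t. ennreal (\<Phi> (cmod (h t) / l)) \<partial>\<mu>) \<le> 1" "ennreal l < ennreal k"
    using less unfolding luxemburg_norm_def INF_less_iff by auto
  have "l < k" using l(3) l(1) by (simp add: ennreal_less_iff)
  have "(\<integral>\<^sup>+ t. ennreal (\<Phi> (cmod (h t) / k)) \<partial>\<mu>) \<le> (\<integral>\<^sup>+ t. ennreal (\<Phi> (cmod (h t) / l)) \<partial>\<mu>)"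
    using l(1) \<open>l < k\<close>
    by (intro nn_integral_mono ennreal_leI young_mono[OF \<Phi>]) (auto intro!: divide_left_mono)
  then show ?thesis using l(2) by simp
qed

lemma luxemburg_leI:
  assumes "\<And>k. k > 0 \<Longrightarrow> C < ennreal k \<Longrightarrow> (\<integral>\<^sup>+ t. ennreal (\<Phi> (cmod (h t) / k)) \<partial>\<mu>) \<le> 1"
  shows "luxemburg_norm \<mu> \<Phi> h \<le> C"
proof (rule dense_ge)
  fix y assume "C < y"
  show "luxemburg_norm \<mu> \<Phi> h \<le> y"
  proof (cases y)
    case (real k)
    then have "k > 0" using \<open>C < y\<close> by (metis ennreal_less_zero_iff le_less_trans zero_le)
    with real \<open>C < y\<close> show ?thesis by (auto intro!: luxemburg_le assms)
  qed simp
qed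

lemma luxemburg_mono_AE:
  assumes \<Phi>: "young_function \<Phi>" and "AE t in \<mu>. cmod (h t) \<le> cmod (h' t)"
  shows "luxemburg_norm \<mu> \<Phi> h \<le> luxemburg_norm \<mu> \<Phi> h'"
proof (rule luxemburg_leI)
  fix k :: real assume k: "k > 0" "luxemburg_norm \<mu> \<Phi> h' < ennreal k"
  have "(\<integral>\<^sup>+ t. ennreal (\<Phi> (cmod (h t) / k)) \<partial>\<mu>) \<le> (\<integral>\<^sup>+ t. ennreal (\<Phi> (cmod (h' t) / k)) \<partial>\<mu>)"
    using assms(2) k(1)
    by (intro nn_integral_mono_AE) (auto elim!: eventually_mono
          intro!: ennreal_leI young_mono[OF \<Phi>] divide_right_mono)
  also have "\<dots> \<le> 1" by (rule luxemburg_lessD[OF \<Phi> k(2)])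
  finally show "(\<integral>\<^sup>+ t. ennreal (\<Phi> (cmod (h t) / k)) \<partial>\<mu>) \<le> 1" .
qed

text \<open>The alternative \<open>h t = 0\<close> is included for convolutions, which are zero by convention at points
where the defining integral diverges.\<close>

lemma luxemburg_fatou:
  assumes \<Phi>: "young_function \<Phi>"
    and [measurable]: "\<And>n. u n \<in> borel_measurable \<mu>"
    and lim: "AE t in \<mu>. h t = 0 \<or> (\<lambda>n. u n t) \<longlonglongrightarrow> h t"
    and le: "\<And>n. luxemburg_norm \<mu> \<Phi> (u n) \<le> C"
  shows "luxemburg_norm \<mu> \<Phi> h \<le> C"
proof (rule luxemburg_leI)
  fix k :: real assume k: "k > 0" "C < ennreal k"
  have [measurable]: "(\<lambda>t. ennreal (\<Phi> (cmod (u n t) / k))) \<in> borel_measurable \<mu>" for n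
    using k(1) by (intro young_measurable[OF \<Phi>]) auto
  have "(\<integral>\<^sup>+ t. ennreal (\<Phi> (cmod (h t) / k)) \<partial>\<mu>)
      \<le> (\<integral>\<^sup>+ t. liminf (\<lambda>n. ennreal (\<Phi> (cmod (u n t) / k))) \<partial>\<mu>)"
  proof (intro nn_integral_mono_AE, use lim in eventually_elim)
    fix t assume "h t = 0 \<or> (\<lambda>n. u n t) \<longlonglongrightarrow> h t"
    then show "ennreal (\<Phi> (cmod (h t) / k)) \<le> liminf (\<lambda>n. ennreal (\<Phi> (cmod (u n t) / k)))"
    proof
      assume "(\<lambda>n. u n t) \<longlonglongrightarrow> h t"
      then have "(\<lambda>n. cmod (u n t) / k) \<longlonglongrightarrow> cmod (h t) / k"
        using k(1) by (intro tendsto_intros) auto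
      then have "(\<lambda>n. \<Phi> (cmod (u n t) / k)) \<longlonglongrightarrow> \<Phi> (cmod (h t) / k)"
        by (rule continuous_on_tendsto_compose[OF young_continuous[OF \<Phi>]]) (use k(1) in auto)
      then have "(\<lambda>n. ennreal (\<Phi> (cmod (u n t) / k))) \<longlonglongrightarrow> ennreal (\<Phi> (cmod (h t) / k))"
        by (rule tendsto_ennrealI)
      then show ?thesis by (simp add: lim_imp_Liminf)
    qed (simp add: young_zero[OF \<Phi>])
  qed
  also have "\<dots> \<le> liminf (\<lambda>n. \<integral>\<^sup>+ t. ennreal (\<Phi> (cmod (u n t) / k)) \<partial>\<mu>)"
    by (rule nn_integral_liminf) measurable
  also have "\<dots> \<le> liminf (\<lambda>n. 1)"
    using le k(2) by (intro Liminf_mono always_eventually allI luxemburg_lessD[OF \<Phi>]) (rule le_less_trans)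
  finally show "(\<integral>\<^sup>+ t. ennreal (\<Phi> (cmod (h t) / k)) \<partial>\<mu>) \<le> 1" by (simp add: Liminf_const)
qed

text \<open>Split \<open>k = a + b\<close> with \<open>a\<close> and \<open>b\<close> above the two norms. Then \<open>(\<bar>h\<bar> + \<bar>h'\<bar>) / k\<close> is the convex
combination of \<open>\<bar>h\<bar> / a\<close> and \<open>\<bar>h'\<bar> / b\<close> with weights \<open>a / k\<close> and \<open>b / k\<close>.\<close>

lemma luxemburg_triangle:
  assumes \<Phi>: "young_function \<Phi>"
    and [measurable]: "h \<in> borel_measurable \<mu>" "h' \<in> borel_measurable \<mu>"
  shows "luxemburg_norm \<mu> \<Phi> (\<lambda>t. h t + h' t) \<le> luxemburg_norm \<mu> \<Phi> h + luxemburg_norm \<mu> \<Phi> h'"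
proof (rule luxemburg_leI)
  fix k :: real
  assume k: "k > 0" and less: "luxemburg_norm \<mu> \<Phi> h + luxemburg_norm \<mu> \<Phi> h' < ennreal k"
  obtain p q where pq: "luxemburg_norm \<mu> \<Phi> h = ennreal p" "p \<ge> 0"
      "luxemburg_norm \<mu> \<Phi> h' = ennreal q" "q \<ge> 0"
    using less by (cases "luxemburg_norm \<mu> \<Phi> h"; cases "luxemburg_norm \<mu> \<Phi> h'") auto
  then have "p + q < k" using less k by (simp add: ennreal_plus[symmetric] ennreal_less_iff del: ennreal_plus)
  define a where "a = (p + (k - q)) / 2"
  define b where "b = k - a"
  have ab: "a > p" "b > q" "a > 0" "b > 0" "a + b = k"
    using \<open>p + q < k\<close> pq by (auto simp: a_def b_def field_simps)
  have I: "(\<integral>\<^sup>+ t. ennreal (\<Phi> (cmod (h t) / a)) \<partial>\<mu>) \<le> 1"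
    "(\<integral>\<^sup>+ t. ennreal (\<Phi> (cmod (h' t) / b)) \<partial>\<mu>) \<le> 1"
    using ab pq by (auto intro!: luxemburg_lessD[OF \<Phi>] simp: ennreal_less_iff)
  have [measurable]: "(\<lambda>t. ennreal (\<Phi> (cmod (h t) / a))) \<in> borel_measurable \<mu>"
      "(\<lambda>t. ennreal (\<Phi> (cmod (h' t) / b))) \<in> borel_measurable \<mu>"
    using ab by (auto intro!: young_measurable[OF \<Phi>])
  have pt: "\<Phi> (cmod (h t + h' t) / k) \<le> (a/k) * \<Phi> (cmod (h t) / a) + (b/k) * \<Phi> (cmod (h' t) / b)" for t
  proof -
    have "\<Phi> (cmod (h t + h' t) / k) \<le> \<Phi> ((cmod (h t) + cmod (h' t)) / k)"
      using k by (intro young_mono[OF \<Phi>] divide_right_mono norm_triangle_ineq) auto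
    also have "(cmod (h t) + cmod (h' t)) / k
        = (a/k) *\<^sub>R (cmod (h t) / a) + (b/k) *\<^sub>R (cmod (h' t) / b)"
      using ab k by (simp add: field_simps)
    also have "\<Phi> \<dots> \<le> (a/k) * \<Phi> (cmod (h t) / a) + (b/k) * \<Phi> (cmod (h' t) / b)"
    proof -
      have "a/k = 1 - b/k" using ab k by (simp add: field_simps)
      then show ?thesis
        using ab k convex_onD[OF young_convex[OF \<Phi>], of "b/k" "cmod (h t) / a" "cmod (h' t) / b"]
        by simp
    qed
    finally show ?thesis .
  qed
  have "(\<integral>\<^sup>+ t. ennreal (\<Phi> (cmod (h t + h' t) / k)) \<partial>\<mu>)
    \<le> (\<integral>\<^sup>+ t. ennreal (a/k) * ennreal (\<Phi> (cmod (h t) / a)) + ennreal (b/k) * ennreal (\<Phi> (cmod (h' t) / b)) \<partial>\<mu>)"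
  proof (rule nn_integral_mono)
    fix t
    have "ennreal (\<Phi> (cmod (h t + h' t) / k))
        \<le> ennreal ((a/k) * \<Phi> (cmod (h t) / a) + (b/k) * \<Phi> (cmod (h' t) / b))"
      using pt by (rule ennreal_leI)
    also have "\<dots> = ennreal (a/k) * ennreal (\<Phi> (cmod (h t) / a)) + ennreal (b/k) * ennreal (\<Phi> (cmod (h' t) / b))"
      using ab k by (simp add: ennreal_plus ennreal_mult young_nonneg[OF \<Phi>] del: times_divide_eq_left)
    finally show "ennreal (\<Phi> (cmod (h t + h' t) / k)) \<le> \<dots>" .
  qed
  also have "\<dots> = ennreal (a/k) * (\<integral>\<^sup>+ t. ennreal (\<Phi> (cmod (h t) / a)) \<partial>\<mu>)
      + ennreal (b/k) * (\<integral>\<^sup>+ t. ennreal (\<Phi> (cmod (h' t) / b)) \<partial>\<mu>)"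
    by (simp add: nn_integral_add nn_integral_cmult)
  also have "\<dots> \<le> ennreal (a/k) * 1 + ennreal (b/k) * 1"
    by (intro add_mono mult_left_mono I) auto
  also have "\<dots> = 1"
    using ab k by (simp add: ennreal_plus[symmetric] add_divide_distrib[symmetric] del: ennreal_plus)
  finally show "(\<integral>\<^sup>+ t. ennreal (\<Phi> (cmod (h t + h' t) / k)) \<partial>\<mu>) \<le> 1" .
qed

lemma luxemburg_zero: "young_function \<Phi> \<Longrightarrow> luxemburg_norm \<mu> \<Phi> (\<lambda>t. 0) = 0"
  using luxemburg_leI[of 0 \<mu> \<Phi> "\<lambda>t. 0"] by (simp add: young_zero)

lemma luxemburg_scale:
  assumes \<Phi>: "young_function \<Phi>"
  shows "luxemburg_norm \<mu> \<Phi> (\<lambda>t. c * h t) \<le> ennreal (cmod c) * luxemburg_norm \<mu> \<Phi> h"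
proof (cases "c = 0")
  case False
  show ?thesis
  proof (rule luxemburg_leI)
    fix k :: real assume k: "k > 0" "ennreal (cmod c) * luxemburg_norm \<mu> \<Phi> h < ennreal k"
    then obtain p where p: "luxemburg_norm \<mu> \<Phi> h = ennreal p" "p \<ge> 0"
      using False by (cases "luxemburg_norm \<mu> \<Phi> h") (auto simp: ennreal_mult_top)
    then have "cmod c * p < k" using k by (simp add: ennreal_mult[symmetric] ennreal_less_iff)
    then have "luxemburg_norm \<mu> \<Phi> h < ennreal (k / cmod c)"
      using p False by (simp add: ennreal_less_iff field_simps)
    then have "(\<integral>\<^sup>+ t. ennreal (\<Phi> (cmod (h t) / (k / cmod c))) \<partial>\<mu>) \<le> 1"
      by (rule luxemburg_lessD[OF \<Phi>])
    then show "(\<integral>\<^sup>+ t. ennreal (\<Phi> (cmod (c * h t) / k)) \<partial>\<mu>) \<le> 1"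
      by (simp add: norm_mult mult.commute)
  qed
qed (simp add: luxemburg_zero[OF \<Phi>])

text \<open>Uniformly small functions have small norm, by continuity of \<open>\<Phi>\<close> at 0. The bound depends on the
measure only through its total mass, which makes it usable for a whole family of measures.\<close>

lemma luxemburg_small:
  assumes \<Phi>: "young_function \<Phi>" and "V \<ge> 0" "e > 0"
  obtains \<eta> where "\<eta> > 0"
    "\<And>\<mu> h. emeasure \<mu> (space \<mu>) \<le> ennreal V \<Longrightarrow> (\<And>t. cmod (h t) \<le> \<eta>) \<Longrightarrow> luxemburg_norm \<mu> \<Phi> h \<le> ennreal e"
proof -
  have "(\<Phi> \<longlongrightarrow> \<Phi> 0) (at 0 within {0..})"
    using young_continuous[OF \<Phi>] by (auto simp: continuous_on_def)
  then have "eventually (\<lambda>x. \<Phi> x < 1 / (V + 1)) (at 0 within {0..})"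
    using assms by (intro order_tendstoD) (auto simp: young_zero[OF \<Phi>])
  then obtain d where d: "d > 0" "\<And>x. x \<ge> 0 \<Longrightarrow> x \<noteq> 0 \<Longrightarrow> x < d \<Longrightarrow> \<Phi> x < 1 / (V + 1)"
    unfolding eventually_at by (auto simp: dist_real_def)
  define \<eta> where "\<eta> = e * (d / 2)"
  show thesis
  proof
    show "\<eta> > 0" using assms d by (simp add: \<eta>_def)
    fix \<mu> :: "'c measure" and h :: "'c \<Rightarrow> complex"
    assume V: "emeasure \<mu> (space \<mu>) \<le> ennreal V" and h: "\<And>t. cmod (h t) \<le> \<eta>"
    have "\<Phi> (cmod (h t) / e) \<le> 1 / (V + 1)" for t
    proof -
      have "\<Phi> (cmod (h t) / e) \<le> \<Phi> (d / 2)"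
        using assms h[of t] by (intro young_mono[OF \<Phi>]) (auto simp: \<eta>_def field_simps)
      also have "\<dots> < 1 / (V + 1)" using d by auto
      finally show ?thesis by simp
    qed
    then have "(\<integral>\<^sup>+ t. ennreal (\<Phi> (cmod (h t) / e)) \<partial>\<mu>) \<le> (\<integral>\<^sup>+ t. ennreal (1 / (V + 1)) \<partial>\<mu>)"
      by (intro nn_integral_mono ennreal_leI)
    also have "\<dots> \<le> ennreal (1 / (V + 1)) * ennreal V" using V by (simp add: mult_left_mono)
    also have "\<dots> \<le> 1" using \<open>V \<ge> 0\<close> by (simp add: ennreal_mult[symmetric] ennreal_le_1 field_simps)
    finally show "luxemburg_norm \<mu> \<Phi> h \<le> ennreal e" using \<open>e > 0\<close> by (intro luxemburg_le)
  qed
qed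

text \<open>If an increasing sequence of moduli were unbounded on a set of positive measure, so would be
\<open>\<Phi> (\<bar>u\<^sub>n\<bar> / k)\<close>, whose integrals stay below 1; monotone convergence excludes this.\<close>

lemma luxemburg_bounded_AE:
  assumes \<Phi>: "young_function \<Phi>"
    and [measurable]: "\<And>n. u n \<in> borel_measurable \<mu>"
    and mono: "\<And>t. incseq (\<lambda>n. cmod (u n t))"
    and le: "\<And>n. luxemburg_norm \<mu> \<Phi> (u n) \<le> C" and "C < \<infinity>"
  shows "AE t in \<mu>. \<exists>B. \<forall>n. cmod (u n t) \<le> B"
proof -
  obtain k where k: "k > 0" "C < ennreal k"
  proof
    show "enn2real C + 1 > 0" by (simp add: add_nonneg_pos)
    show "C < ennreal (enn2real C + 1)" using \<open>C < \<infinity>\<close> by (cases C) (auto simp: ennreal_less_iff)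
  qed
  let ?F = "\<lambda>n t. ennreal (\<Phi> (cmod (u n t) / k))"
  have [measurable]: "?F n \<in> borel_measurable \<mu>" for n
    using k(1) by (intro young_measurable[OF \<Phi>]) auto
  have inc: "incseq ?F"
    using mono k(1) by (auto simp: incseq_def le_fun_def intro!: ennreal_leI young_mono[OF \<Phi>] divide_right_mono)
  have "(\<integral>\<^sup>+ t. (SUP n. ?F n t) \<partial>\<mu>) = (SUP n. \<integral>\<^sup>+ t. ?F n t \<partial>\<mu>)"
    using inc by (intro nn_integral_monotone_convergence_SUP) auto
  also have "\<dots> \<le> 1"
    using le k(2) by (intro SUP_least luxemburg_lessD[OF \<Phi>]) (rule le_less_trans)
  finally have "(\<integral>\<^sup>+ t. (SUP n. ?F n t) \<partial>\<mu>) \<noteq> \<infinity>" by (auto simp: top_unique)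
  then have "AE t in \<mu>. (SUP n. ?F n t) \<noteq> \<infinity>" by (intro nn_integral_PInf_AE) auto
  then show ?thesis
  proof eventually_elim
    fix t assume "(SUP n. ?F n t) \<noteq> \<infinity>"
    then obtain b where b: "(SUP n. ?F n t) = ennreal b" "b \<ge> 0" by (cases "SUP n. ?F n t") auto
    have le_b: "\<Phi> (cmod (u n t) / k) \<le> b" for n
      using SUP_upper[of n UNIV "\<lambda>n. ?F n t"] b by (simp add: ennreal_le_iff)
    have "eventually (\<lambda>x. \<Phi> x > b) at_top"
      using young_at_top[OF \<Phi>] by (simp add: filterlim_at_top_dense)
    then obtain x0 where x0: "\<And>x. x \<ge> x0 \<Longrightarrow> \<Phi> x > b" unfolding eventually_at_top_linorder by blast
    have "cmod (u n t) \<le> x0 * k" for n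
    proof -
      have "cmod (u n t) / k \<le> x0" using le_b[of n] x0[of "cmod (u n t) / k"] by linarith
      then show ?thesis using k(1) by (simp add: field_simps)
    qed
    then show "\<exists>B. \<forall>n. cmod (u n t) \<le> B" by blast
  qed
qed

section \<open>The Orlicz norm of a vector measure\<close>

lemma luxemburg_distr:
  assumes \<Phi>: "young_function \<Phi>" and T: "T \<in> measurable \<mu> M" and g: "g \<in> borel_measurable M"
  shows "luxemburg_norm (distr \<mu> M T) \<Phi> g = luxemburg_norm \<mu> \<Phi> (\<lambda>t. g (T t))"
proof -
  have "(\<integral>\<^sup>+ t. ennreal (\<Phi> (cmod (g t) / k)) \<partial>distr \<mu> M T) = (\<integral>\<^sup>+ t. ennreal (\<Phi> (cmod (g (T t)) / k)) \<partial>\<mu>)"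
    if "k > 0" for k
    using that young_measurable[OF \<Phi> _ g, of k] by (intro nn_integral_distr T) auto
  then show ?thesis
    unfolding luxemburg_norm_def by (intro arg_cong[of _ _ Inf] image_cong Collect_cong refl) auto
qed

lemma orlicz_leI:
  "(\<And>x'. x' \<in> dual_unit_ball \<Longrightarrow> luxemburg_norm (variation_measure (\<lambda>A. x' (\<nu> A))) \<Phi> h \<le> C)
    \<Longrightarrow> orlicz_norm \<nu> \<Phi> h \<le> C"
  unfolding orlicz_norm_def by (rule SUP_least)

lemma luxemburg_le_orlicz:
  "x' \<in> dual_unit_ball \<Longrightarrow> luxemburg_norm (variation_measure (\<lambda>A. x' (\<nu> A))) \<Phi> h \<le> orlicz_norm \<nu> \<Phi> h"
  unfolding orlicz_norm_def by (rule SUP_upper)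

lemma measurable_variation_measure [simp]:
  "measurable (variation_measure \<mu>) N = measurable borel N"
  by (rule measurable_cong_sets) auto

lemma orlicz_norm_translate_le:
  fixes \<nu> :: "'g::topological_group_add set \<Rightarrow> 'x::complex_banach"
  assumes \<Phi>: "young_function \<Phi>" and \<nu>: "vector_measure \<nu>"
    and inv: "norm_integral_translation_invariant \<nu>" and g: "g \<in> borel_measurable borel"
  shows "orlicz_norm \<nu> \<Phi> (translate s g) \<le> orlicz_norm \<nu> \<Phi> g"
proof (rule orlicz_leI)
  fix x' :: "'x \<Rightarrow> complex" assume x': "x' \<in> dual_unit_ball"
  obtain y' where y': "y' \<in> dual_unit_ball" "\<And>A. A \<in> sets borel \<Longrightarrow> y' (\<nu> A) = x' (\<nu> ((+) s ` A))"
    using translated_functional[OF \<nu> inv x'] by metis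
  have eq: "variation_measure (\<lambda>A. y' (\<nu> A))
      = distr (variation_measure (\<lambda>A. x' (\<nu> A))) borel (\<lambda>t. - s + t)"
    by (rule variation_measure_translated_functional[OF \<nu> x' y'])
  have "luxemburg_norm (variation_measure (\<lambda>A. x' (\<nu> A))) \<Phi> (translate s g)
      = luxemburg_norm (variation_measure (\<lambda>A. y' (\<nu> A))) \<Phi> g"
    unfolding eq translate_def
    by (rule luxemburg_distr[OF \<Phi> _ g, symmetric]) simp
  also have "\<dots> \<le> orlicz_norm \<nu> \<Phi> g" by (rule luxemburg_le_orlicz[OF y'(1)])
  finally show "luxemburg_norm (variation_measure (\<lambda>A. x' (\<nu> A))) \<Phi> (translate s g) \<le> orlicz_norm \<nu> \<Phi> g" .
qed

lemma orlicz_mono: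
  assumes "young_function \<Phi>" "\<And>t. cmod (h t) \<le> cmod (h' t)"
  shows "orlicz_norm \<nu> \<Phi> h \<le> orlicz_norm \<nu> \<Phi> h'"
  using assms by (intro orlicz_leI order_trans[OF luxemburg_mono_AE luxemburg_le_orlicz]) auto

lemma orlicz_triangle:
  assumes "young_function \<Phi>" "h \<in> borel_measurable borel" "h' \<in> borel_measurable borel"
  shows "orlicz_norm \<nu> \<Phi> (\<lambda>t. h t + h' t) \<le> orlicz_norm \<nu> \<Phi> h + orlicz_norm \<nu> \<Phi> h'"
  using assms
  by (intro orlicz_leI order_trans[OF luxemburg_triangle add_mono[OF luxemburg_le_orlicz luxemburg_le_orlicz]]) auto

lemma orlicz_scale:
  assumes "young_function \<Phi>"
  shows "orlicz_norm \<nu> \<Phi> (\<lambda>t. c * h t) \<le> ennreal (cmod c) * orlicz_norm \<nu> \<Phi> h"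
  using assms
  by (intro orlicz_leI order_trans[OF luxemburg_scale mult_left_mono[OF luxemburg_le_orlicz]]) auto

lemma orlicz_linear_combination:
  assumes \<Phi>: "young_function \<Phi>" and "finite I"
    and "\<And>i. i \<in> I \<Longrightarrow> h i \<in> borel_measurable borel"
    and "\<And>i. i \<in> I \<Longrightarrow> orlicz_norm \<nu> \<Phi> (h i) \<le> N"
  shows "orlicz_norm \<nu> \<Phi> (\<lambda>t. \<Sum>i\<in>I. c i * h i t) \<le> ennreal (\<Sum>i\<in>I. cmod (c i)) * N"
  using assms(2-)
proof (induction I rule: finite_induct)
  case empty
  have "orlicz_norm \<nu> \<Phi> (\<lambda>t. 0) \<le> 0" by (rule orlicz_leI) (simp add: luxemburg_zero[OF \<Phi>])
  then show ?case by simp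
next
  case (insert i I)
  have "orlicz_norm \<nu> \<Phi> (\<lambda>t. c i * h i t + (\<Sum>i\<in>I. c i * h i t))
      \<le> orlicz_norm \<nu> \<Phi> (\<lambda>t. c i * h i t) + orlicz_norm \<nu> \<Phi> (\<lambda>t. \<Sum>i\<in>I. c i * h i t)"
    using insert by (intro orlicz_triangle[OF \<Phi>]) auto
  also have "\<dots> \<le> ennreal (cmod (c i)) * N + ennreal (\<Sum>i\<in>I. cmod (c i)) * N"
    using insert by (intro add_mono order_trans[OF orlicz_scale[OF \<Phi>]] mult_left_mono) auto
  also have "\<dots> = ennreal (\<Sum>i\<in>insert i I. cmod (c i)) * N"
    using insert by (simp add: ennreal_plus sum_nonneg distrib_right)
  finally show ?case using insert by simp
qed

lemma orlicz_fatou: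
  assumes \<Phi>: "young_function \<Phi>"
    and "\<And>n. u n \<in> borel_measurable borel"
    and "\<And>x'. x' \<in> dual_unit_ball \<Longrightarrow>
      AE t in variation_measure (\<lambda>A. x' (\<nu> A)). h t = 0 \<or> (\<lambda>n. u n t) \<longlonglongrightarrow> h t"
    and le: "\<And>n. orlicz_norm \<nu> \<Phi> (u n) \<le> C"
  shows "orlicz_norm \<nu> \<Phi> h \<le> C"
proof (rule orlicz_leI)
  fix x' :: "'b \<Rightarrow> complex" assume x': "x' \<in> dual_unit_ball"
  show "luxemburg_norm (variation_measure (\<lambda>A. x' (\<nu> A))) \<Phi> h \<le> C"
  proof (rule luxemburg_fatou[OF \<Phi>])
    show "u n \<in> borel_measurable (variation_measure (\<lambda>A. x' (\<nu> A)))" for n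
      using assms(2) by simp
    show "luxemburg_norm (variation_measure (\<lambda>A. x' (\<nu> A))) \<Phi> (u n) \<le> C" for n
      using luxemburg_le_orlicz[OF x'] le by (rule order_trans)
  qed (rule assms(3)[OF x'])
qed

section \<open>Null sets and total mass of the scalar variations\<close>

text \<open>Absolute continuity makes \<open>\<nu>\<close> vanish on every Borel subset of an \<open>m\<close>-null set, so that the variation
of each \<open>x' \<circ> \<nu>\<close> vanishes on it.\<close>

lemma AE_variation_measure:
  assumes \<nu>: "vector_measure \<nu>" and ac: "abs_continuous m \<nu>" and x': "x' \<in> dual_unit_ball"
    and m: "sets m = sets borel" and AE: "AE t in m. P t"
  shows "AE t in variation_measure (\<lambda>A. x' (\<nu> A)). P t"
proof -
  obtain N where N: "N \<in> null_sets m" "{t \<in> space m. \<not> P t} \<subseteq> N"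
    using AE by (auto elim!: AE_E simp: null_sets_def)
  have "space m = UNIV" using sets_eq_imp_space_eq[OF m] by simp
  have "variation (\<lambda>A. x' (\<nu> A)) N \<le> 0"
    unfolding variation_def
  proof (rule SUP_least, clarify)
    fix A :: "nat \<Rightarrow> _" assume A: "range A \<subseteq> sets borel" "N = (\<Union>n. A n)"
    have "x' (\<nu> (A n)) = 0" for n
    proof -
      have "emeasure m (A n) \<le> emeasure m N" using A N m by (intro emeasure_mono) auto
      then have "measure m (A n) = 0" using N by (simp add: measure_def null_sets_def)
      then have "norm (\<nu> (A n)) < \<epsilon>" if "\<epsilon> > 0" for \<epsilon>
        using ac that A(1) unfolding abs_continuous_def by (metis range_subsetD)
      then have "norm (\<nu> (A n)) = 0" using norm_not_less_zero by (metis less_irrefl zero_less_norm_iff norm_eq_zero)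
      then show ?thesis using dual_unit_ballD(3)[OF x', of "\<nu> (A n)"] by simp
    qed
    then show "(\<Sum>n. ennreal (cmod (x' (\<nu> (A n))))) \<le> 0" by simp
  qed
  then have "emeasure (variation_measure (\<lambda>A. x' (\<nu> A))) N = 0"
    using N m by (subst emeasure_variation_measure[OF vector_measure_functional[OF \<nu> x']]) (auto simp: null_sets_def)
  then show ?thesis
    using N m \<open>space m = UNIV\<close> by (intro AE_I[of _ _ N]) (auto simp: null_sets_def)
qed

text \<open>Split into real and imaginary parts and each of these into its positive and negative terms; the
four resulting partial sums are at most \<open>B\<close>.\<close>

lemma sum_cmod_le_of_subset_sums:
  assumes J: "finite J" and B: "\<And>K. K \<subseteq> J \<Longrightarrow> cmod (\<Sum>n\<in>K. z n) \<le> B"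
  shows "(\<Sum>n\<in>J. cmod (z n)) \<le> 4 * B"
proof -
  have real: "(\<Sum>n\<in>J. \<bar>r n\<bar>) \<le> 2 * B" if r: "\<And>K. K \<subseteq> J \<Longrightarrow> \<bar>\<Sum>n\<in>K. r n\<bar> \<le> B" for r :: "'a \<Rightarrow> real"
  proof -
    have "(\<Sum>n\<in>J. \<bar>r n\<bar>) = (\<Sum>n\<in>J \<inter> {n. r n \<ge> 0}. \<bar>r n\<bar>) + (\<Sum>n\<in>J \<inter> - {n. r n \<ge> 0}. \<bar>r n\<bar>)"
      using J by (subst sum.union_disjoint[symmetric]) (auto intro!: sum.cong)
    also have "\<dots> = (\<Sum>n\<in>J \<inter> {n. r n \<ge> 0}. r n) - (\<Sum>n\<in>J \<inter> - {n. r n \<ge> 0}. r n)"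
      by (simp add: sum_negf[symmetric])
    also have "\<dots> \<le> B + B"
      using r[of "J \<inter> {n. r n \<ge> 0}"] r[of "J \<inter> - {n. r n \<ge> 0}"] by (simp add: abs_le_iff)
    finally show ?thesis by simp
  qed
  have "(\<Sum>n\<in>J. cmod (z n)) \<le> (\<Sum>n\<in>J. \<bar>Re (z n)\<bar>) + (\<Sum>n\<in>J. \<bar>Im (z n)\<bar>)"
    unfolding sum.distrib[symmetric] by (intro sum_mono cmod_le)
  also have "\<dots> \<le> 2 * B + 2 * B"
    using abs_Re_le_cmod abs_Im_le_cmod B
    by (intro add_mono real) (metis Re_sum Im_sum order_trans)+
  finally show ?thesis by simp
qed

lemma variation_le_of_bounded:
  assumes \<mu>: "vector_measure \<mu>" and B: "\<And>A. A \<in> sets borel \<Longrightarrow> cmod (\<mu> A) \<le> B"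
  shows "variation \<mu> E \<le> ennreal (4 * B)"
  unfolding variation_def
proof (rule SUP_least, clarify)
  fix A :: "nat \<Rightarrow> 'a set" assume A: "range A \<subseteq> sets borel" "disjoint_family A"
  have "(\<Sum>n<N. ennreal (cmod (\<mu> (A n)))) \<le> ennreal (4 * B)" for N
  proof -
    have "cmod (\<Sum>n\<in>K. \<mu> (A n)) \<le> B" if "K \<subseteq> {..<N}" for K
    proof -
      have "finite K" using that finite_subset by blast
      then have "(\<Sum>n\<in>K. \<mu> (A n)) = \<mu> (\<Union>n\<in>K. A n)"
        using A by (intro vector_measure_UN[OF \<mu>, symmetric]) (auto simp: disjoint_family_on_def)
      moreover have "(\<Union>n\<in>K. A n) \<in> sets borel"
        using \<open>finite K\<close> A(1) by (intro sets.finite_UN) auto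
      ultimately show ?thesis using B by simp
    qed
    then show ?thesis
      using sum_cmod_le_of_subset_sums[of "{..<N}" "\<lambda>n. \<mu> (A n)" B] by (simp add: sum_ennreal ennreal_leI)
  qed
  then show "(\<Sum>n. ennreal (cmod (\<mu> (A n)))) \<le> ennreal (4 * B)"
    by (intro suminf_le_const) auto
qed

section \<open>Approximation by simple and by continuous functions\<close>

lemma uniform_simple_approximation:
  fixes h :: "'a \<Rightarrow> complex"
  assumes [measurable]: "h \<in> borel_measurable M" and B: "\<And>t. cmod (h t) \<le> B" and "e > 0"
  obtains \<phi> where "simple_function M \<phi>" "\<And>t. cmod (h t - \<phi> t) \<le> e"
proof -
  define d where "d = e / 2"
  have d: "d > 0" using \<open>e > 0\<close> by (simp add: d_def)
  define q where "q x = d * real_of_int \<lfloor>x / d\<rfloor>" for x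
  define \<phi> where "\<phi> t = complex_of_real (q (Re (h t))) + \<i> * complex_of_real (q (Im (h t)))" for t
  have q: "\<bar>x - q x\<bar> \<le> d" for x
  proof -
    have "d * real_of_int \<lfloor>x / d\<rfloor> \<le> d * (x / d)" "d * (x / d) \<le> d * (real_of_int \<lfloor>x / d\<rfloor> + 1)"
      using d by (intro mult_left_mono; linarith)+
    then show ?thesis using d by (simp add: q_def abs_le_iff distrib_left)
  qed
  let ?N = "\<lceil>B / d\<rceil> + 1"
  have fl: "\<lfloor>x / d\<rfloor> \<in> {-?N..?N}" if "\<bar>x\<bar> \<le> B" for x
  proof -
    have "x / d \<le> B / d" "- (B / d) \<le> x / d" using that d by (auto simp: field_simps abs_le_iff)
    then show ?thesis unfolding atLeastAtMost_iff by linarith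
  qed
  have "range \<phi> \<subseteq> (\<lambda>(i, j). complex_of_real (d * real_of_int i) + \<i> * complex_of_real (d * real_of_int j))
      ` ({-?N..?N} \<times> {-?N..?N})"
  proof (rule image_subsetI)
    fix t
    have "\<bar>Re (h t)\<bar> \<le> B" "\<bar>Im (h t)\<bar> \<le> B"
      using B[of t] abs_Re_le_cmod[of "h t"] abs_Im_le_cmod[of "h t"] by linarith+
    from fl[OF this(1)] fl[OF this(2)]
    show "\<phi> t \<in> (\<lambda>(i, j). complex_of_real (d * real_of_int i) + \<i> * complex_of_real (d * real_of_int j))
      ` ({-?N..?N} \<times> {-?N..?N})"
      by (intro image_eqI[of _ _ "(\<lfloor>Re (h t) / d\<rfloor>, \<lfloor>Im (h t) / d\<rfloor>)"]) (auto simp: \<phi>_def q_def)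
  qed
  then have "finite (range \<phi>)" by (rule finite_subset) auto
  then have "finite (\<phi> ` space M)" by (rule finite_subset[rotated]) auto
  moreover have "\<phi> \<in> borel_measurable M" unfolding \<phi>_def q_def by measurable
  ultimately have "simple_function M \<phi>" by (simp add: simple_function_borel_measurable)
  moreover have "cmod (h t - \<phi> t) \<le> e" for t
  proof -
    have "cmod (h t - \<phi> t) \<le> \<bar>Re (h t - \<phi> t)\<bar> + \<bar>Im (h t - \<phi> t)\<bar>" by (rule cmod_le)
    also have "\<dots> \<le> d + d" using q[of "Re (h t)"] q[of "Im (h t)"] by (simp add: \<phi>_def)
    finally show ?thesis by (simp add: d_def)
  qed
  ultimately show thesis by (rule that)
qed

text \<open>In a compact space this includes inner regularity, by taking complements.\<close>

definition outer_regular :: "'a::topological_space measure \<Rightarrow> bool" where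
  "outer_regular N \<longleftrightarrow> sets N = sets borel \<and> finite_measure N \<and>
     (\<forall>A\<in>sets borel. \<forall>e>0. \<exists>U. open U \<and> A \<subseteq> U \<and> measure N (U - A) < e)"

text \<open>Enclose \<open>A\<close> between a closed and an open set whose difference is small for both measures and apply
Urysohn's lemma. One function for two measures is obtained by intersecting the open sets found for
each of them.\<close>

lemma indicator_continuous_approximation:
  fixes N1 N2 :: "'a::t2_space measure"
  assumes cpt: "compact (UNIV :: 'a set)"
    and N: "outer_regular N1" "outer_regular N2" and A: "A \<in> sets borel" and "e > 0"
  obtains c :: "'a \<Rightarrow> real" where "continuous_on UNIV c" "\<And>t. \<bar>c t\<bar> \<le> 1"
    "(LINT t|N1. \<bar>indicator A t - c t\<bar>) \<le> e" "(LINT t|N2. \<bar>indicator A t - c t\<bar>) \<le> e"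
proof -
  have sets: "sets N1 = sets borel" "sets N2 = sets borel" and fin: "finite_measure N1" "finite_measure N2"
    using N by (auto simp: outer_regular_def)
  have outer: "\<exists>U. open U \<and> B \<subseteq> U \<and> measure N1 (U - B) < e / 2 \<and> measure N2 (U - B) < e / 2"
    if B: "B \<in> sets borel" for B
  proof -
    obtain U1 U2 where U: "open U1" "B \<subseteq> U1" "measure N1 (U1 - B) < e / 2"
      "open U2" "B \<subseteq> U2" "measure N2 (U2 - B) < e / 2"
      using N B \<open>e > 0\<close> unfolding outer_regular_def by (metis half_gt_zero)
    have "measure N1 (U1 \<inter> U2 - B) \<le> measure N1 (U1 - B)"
      "measure N2 (U1 \<inter> U2 - B) \<le> measure N2 (U2 - B)"
      using U B fin sets by (auto intro!: finite_measure.finite_measure_mono)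
    then show ?thesis using U by (intro exI[of _ "U1 \<inter> U2"]) auto
  qed
  obtain U where U: "open U" "A \<subseteq> U" "measure N1 (U - A) < e / 2" "measure N2 (U - A) < e / 2"
    using outer[OF A] by blast
  obtain W where W: "open W" "- A \<subseteq> W" "measure N1 (W - (- A)) < e / 2" "measure N2 (W - (- A)) < e / 2"
    using outer[of "- A"] A by (auto simp: borel_comp)
  have "Hausdorff_space (euclidean :: 'a topology)"
    unfolding Hausdorff_space_def by (metis hausdorff open_openin disjnt_def)
  then have "normal_space (euclidean :: 'a topology)"
    using cpt by (intro compact_Hausdorff_or_regular_imp_normal_space) (auto simp: compact_space_def)
  then obtain c :: "'a \<Rightarrow> real" where c: "continuous_map euclidean (top_of_set {0..1}) c"
      "c ` (- U) \<subseteq> {0}" "c ` (- W) \<subseteq> {1}"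
    using Urysohn_lemma[of euclidean "- U" "- W" 0 1] U W
    by (auto simp: disjnt_def)
  have cont: "continuous_on UNIV c" and c01: "\<And>t. c t \<in> {0..1}"
    using c(1) by (auto simp: continuous_map_in_subtopology)
  have le: "\<bar>indicator A t - c t\<bar> \<le> indicator (U \<inter> W) t" for t
    using c01[of t] c(2,3) U(2) W(2) by (auto simp: indicator_def image_subset_iff)
  have small: "(LINT t|N. \<bar>indicator A t - c t\<bar>) \<le> e"
    if N: "finite_measure N" "sets N = sets borel"
      and less: "measure N (U - A) < e / 2" "measure N (W - (- A)) < e / 2" for N
  proof -
    interpret finite_measure N by (rule N)
    note [measurable_cong] = N(2)
    have [measurable]: "c \<in> borel_measurable borel" "A \<in> sets borel" "U \<in> sets borel" "W \<in> sets borel"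
      using cont A U W by (auto intro: borel_measurable_continuous_onI)
    have "(LINT t|N. \<bar>indicator A t - c t\<bar>) \<le> (LINT t|N. indicator (U \<inter> W) t)"
    proof (rule integral_mono)
      show "integrable N (\<lambda>t. \<bar>indicator A t - c t\<bar>)"
      proof (intro integrable_const_bound[of _ 2] AE_I2)
        show "norm \<bar>indicator A t - c t\<bar> \<le> 2" for t
          using c01[of t] by (auto simp: indicator_def)
      qed measurable
      show "integrable N (\<lambda>t. indicator (U \<inter> W) t :: real)"
        by (intro integrable_const_bound[of _ 2]) (auto simp: indicator_def)
    qed (rule le)
    also have "\<dots> = measure N (U \<inter> W)"
      using sets_eq_imp_space_eq[OF N(2)] by simp
    also have "\<dots> \<le> measure N ((U - A) \<union> (W - (- A)))"
      using N(2) by (intro finite_measure_mono) auto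
    also have "\<dots> \<le> measure N (U - A) + measure N (W - (- A))"
      using N(2) by (intro measure_Un_le) auto
    also have "\<dots> \<le> e" using less by simp
    finally show ?thesis .
  qed
  show thesis
  proof (rule that[OF cont])
    show "\<bar>c t\<bar> \<le> 1" for t using c01[of t] by auto
  qed (use small fin sets U W in auto)
qed

lemma L1_continuous_approximation:
  fixes N1 N2 :: "'a::t2_space measure" and g :: "'a \<Rightarrow> complex"
  assumes cpt: "compact (UNIV :: 'a set)"
    and N: "outer_regular N1" "outer_regular N2"
    and g: "g \<in> borel_measurable borel" and B: "\<And>t. cmod (g t) \<le> B" and "e > 0"
  obtains c where "continuous_on UNIV c"
    "(LINT t|N1. cmod (g t - c t)) \<le> e" "(LINT t|N2. cmod (g t - c t)) \<le> e"
proof -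
  have sets: "sets N1 = sets borel" "sets N2 = sets borel" and fin: "finite_measure N1" "finite_measure N2"
    using N by (auto simp: outer_regular_def)
  define K where "K = measure N1 UNIV + measure N2 UNIV + 1"
  have K: "K > 0" "measure N1 UNIV \<le> K" "measure N2 UNIV \<le> K" by (simp_all add: K_def add_nonneg_pos)
  obtain \<phi> where \<phi>: "simple_function borel \<phi>" "\<And>t. cmod (g t - \<phi> t) \<le> e / (2 * K)"
  proof -
    have "e / (2 * K) > 0" using \<open>e > 0\<close> K by simp
    from uniform_simple_approximation[OF g B this] that show thesis by blast
  qed
  define S where "S = (\<Sum>z\<in>range \<phi>. cmod z) + 1"
  have S: "S > 0" by (simp add: S_def sum_nonneg add_nonneg_pos)
  define Q where "Q z c \<longleftrightarrow> continuous_on UNIV c \<and> (\<forall>t. \<bar>c t\<bar> \<le> 1)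
      \<and> (LINT t|N1. \<bar>indicator (\<phi> -` {z}) t - c t\<bar>) \<le> e / (2 * S)
      \<and> (LINT t|N2. \<bar>indicator (\<phi> -` {z}) t - c t\<bar>) \<le> e / (2 * S)" for z and c :: "'a \<Rightarrow> real"
  have "\<exists>c. Q z c" for z
  proof -
    have "e / (2 * S) > 0" using \<open>e > 0\<close> S by simp
    from indicator_continuous_approximation[OF cpt N simple_function_borelD(2)[OF \<phi>(1), of z] this]
    show ?thesis unfolding Q_def by blast
  qed
  then obtain c where "\<And>z. Q z (c z)" by metis
  then have c: "\<And>z. continuous_on UNIV (c z)" "\<And>z t. \<bar>c z t\<bar> \<le> 1"
      "\<And>z. (LINT t|N1. \<bar>indicator (\<phi> -` {z}) t - c z t\<bar>) \<le> e / (2 * S)"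
      "\<And>z. (LINT t|N2. \<bar>indicator (\<phi> -` {z}) t - c z t\<bar>) \<le> e / (2 * S)"
    by (simp_all add: Q_def)
  define C where "C t = (\<Sum>z\<in>range \<phi>. z * complex_of_real (c z t))" for t
  have contC: "continuous_on UNIV C"
    unfolding C_def using c(1) by (intro continuous_intros) auto
  have fin_range: "finite (range \<phi>)" by (rule simple_function_borelD[OF \<phi>(1)])
  have pt: "cmod (g t - C t) \<le> e / (2 * K) + (\<Sum>z\<in>range \<phi>. cmod z * \<bar>indicator (\<phi> -` {z}) t - c z t\<bar>)" for t
  proof -
    have "\<phi> t = (\<Sum>z\<in>range \<phi>. if z = \<phi> t then z else 0)" using fin_range by simp
    also have "\<dots> = (\<Sum>z\<in>range \<phi>. z * complex_of_real (indicator (\<phi> -` {z}) t))"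
      by (intro sum.cong) (auto simp: indicator_def)
    finally have "\<phi> t - C t = (\<Sum>z\<in>range \<phi>. z * complex_of_real (indicator (\<phi> -` {z}) t - c z t))"
      unfolding C_def of_real_diff right_diff_distrib sum_subtractf by (rule arg_cong)
    then have "cmod (\<phi> t - C t) \<le> (\<Sum>z\<in>range \<phi>. cmod z * \<bar>indicator (\<phi> -` {z}) t - c z t\<bar>)"
      by (simp only:) (intro order_trans[OF norm_sum] sum_mono, simp add: norm_mult of_real_diff[symmetric] del: of_real_diff)
    then show ?thesis using \<phi>(2)[of t] norm_triangle_ineq[of "g t - \<phi> t" "\<phi> t - C t"] by simp
  qed
  have small: "(LINT t|N. cmod (g t - C t)) \<le> e"
    if N: "finite_measure N" "sets N = sets borel" "measure N UNIV \<le> K"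
      and le: "\<And>z. (LINT t|N. \<bar>indicator (\<phi> -` {z}) t - c z t\<bar>) \<le> e / (2 * S)" for N
  proof -
    interpret finite_measure N by (rule N)
    note [measurable_cong] = N(2)
    have sp: "space N = UNIV" using sets_eq_imp_space_eq[OF N(2)] by simp
    note [measurable] = g borel_measurable_continuous_onI[OF c(1)] borel_measurable_continuous_onI[OF contC]
      simple_function_borelD(2)[OF \<phi>(1)]
    have int: "integrable N (\<lambda>t. \<bar>indicator (\<phi> -` {z}) t - c z t\<bar>)" for z
    proof (intro integrable_const_bound[of _ 2] AE_I2)
      show "norm \<bar>indicator (\<phi> -` {z}) t - c z t\<bar> \<le> 2" for t
        using c(2)[of z t] by (auto simp: indicator_def)
    qed measurable
    let ?R = "\<lambda>t. e / (2 * K) + (\<Sum>z\<in>range \<phi>. cmod z * \<bar>indicator (\<phi> -` {z}) t - c z t\<bar>)"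
    have intR: "integrable N ?R" using int by (intro Bochner_Integration.integrable_add Bochner_Integration.integrable_sum) auto
    have "(LINT t|N. cmod (g t - C t)) \<le> (LINT t|N. ?R t)"
    proof (rule integral_mono[OF _ intR pt])
      show "integrable N (\<lambda>t. cmod (g t - C t))"
        using pt order_trans[OF pt abs_ge_self] by (intro Bochner_Integration.integrable_bound[OF intR]) auto
    qed
    also have "\<dots> = e / (2 * K) * measure N UNIV
        + (\<Sum>z\<in>range \<phi>. cmod z * (LINT t|N. \<bar>indicator (\<phi> -` {z}) t - c z t\<bar>))"
      using int by (subst Bochner_Integration.integral_add) (auto simp: Bochner_Integration.integral_sum sp mult.commute)
    also have "\<dots> \<le> e / (2 * K) * K + (\<Sum>z\<in>range \<phi>. cmod z * (e / (2 * S)))"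
      using N(3) le K \<open>e > 0\<close> by (intro add_mono sum_mono mult_left_mono) auto
    also have "\<dots> = e / 2 + (S - 1) * (e / (2 * S))"
      unfolding sum_distrib_right[symmetric] using K by (simp add: S_def)
    also have "\<dots> \<le> e / 2 + S * (e / (2 * S))"
      using S \<open>e > 0\<close> by (intro add_left_mono mult_right_mono) auto
    also have "\<dots> = e" using S by simp
    finally show ?thesis .
  qed
  show thesis using that[OF contC] small fin sets K c by blast
qed

text \<open>By the tube lemma: continuity in \<open>u\<close> at the identity is uniform in the compact variable \<open>x\<close>. The group
need not be commutative, and both sides are used: the first estimate for approximating a
convolution by translates, the second for its continuity.\<close>

lemma uniform_continuity_translation:
  fixes c :: "'g::topological_group_add \<Rightarrow> complex"
  assumes cpt: "compact (UNIV :: 'g set)" and c: "continuous_on UNIV c" and "e > 0"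
  obtains U where "open U" "0 \<in> U" "\<And>u x. u \<in> U \<Longrightarrow> cmod (c (- u + x) - c x) \<le> e"
      "\<And>u x. u \<in> U \<Longrightarrow> cmod (c (x + u) - c x) \<le> e"
proof -
  have l: "continuous_on (UNIV \<times> UNIV) (\<lambda>(u, x). c (- u + x))"
    and r: "continuous_on (UNIV \<times> UNIV) (\<lambda>(u, x). c (x + u))"
    unfolding case_prod_beta
    by (intro continuous_on_compose2[OF c] continuous_intros; simp)+
  obtain U1 where U1: "0 \<in> U1" "open U1"
      "\<forall>u\<in>U1 \<inter> UNIV. \<forall>x\<in>UNIV. dist ((\<lambda>(u, x). c (- u + x)) (u, x)) ((\<lambda>(u, x). c (- u + x)) (0, x)) \<le> e"
    using continuous_on_prod_compactE[OF l cpt UNIV_I \<open>e > 0\<close>] by blast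
  obtain U2 where U2: "0 \<in> U2" "open U2"
      "\<forall>u\<in>U2 \<inter> UNIV. \<forall>x\<in>UNIV. dist ((\<lambda>(u, x). c (x + u)) (u, x)) ((\<lambda>(u, x). c (x + u)) (0, x)) \<le> e"
    using continuous_on_prod_compactE[OF r cpt UNIV_I \<open>e > 0\<close>] by blast
  show thesis
    by (rule that[of "U1 \<inter> U2"]) (use U1 U2 in \<open>auto simp: dist_norm\<close>)
qed

section \<open>Convolution of bounded functions\<close>

lemma norm_integral_le_integral:
  fixes h :: "'a \<Rightarrow> 'b::{banach, second_countable_topology}"
  assumes "integrable M h" "integrable M b" "\<And>x. norm (h x) \<le> b x"
  shows "norm (LINT x|M. h x) \<le> (LINT x|M. b x)"
  by (rule order_trans[OF integral_norm_bound integral_mono[OF integrable_norm[OF assms(1)] assms(2,3)]])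

locale compact_haar =
  fixes m :: "'g::{topological_group_add, t2_space} measure"
  assumes compact_UNIV: "compact (UNIV :: 'g set)"
    and haar: "normalized_haar_measure m"
begin

lemma sets_haar [simp, measurable_cong]: "sets m = sets borel"
  using haar by (simp add: normalized_haar_measure_def)

lemma space_haar [simp]: "space m = UNIV"
  using sets_eq_imp_space_eq[OF sets_haar] by simp

lemma measurable_haar [simp]: "measurable m N = measurable borel N"
  by (rule measurable_cong_sets) auto

sublocale finite_measure m
proof (rule finite_measureI)
  have "emeasure m UNIV = 1" using haar unfolding normalized_haar_measure_def by blast
  then show "emeasure m (space m) \<noteq> \<infinity>" by simp
qed

lemma haar_translation: "distr m m (\<lambda>t. s + t) = m"
proof (rule measure_eqI)
  fix A assume "A \<in> sets (distr m m (\<lambda>t. s + t))"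
  then have A: "A \<in> sets borel" by simp
  have "(\<lambda>t. s + t) \<in> measurable m m"
    using measurable_translation(1) by (simp add: measurable_cong_sets[OF sets_haar sets_haar])
  then have "emeasure (distr m m (\<lambda>t. s + t)) A = emeasure m ((\<lambda>t. s + t) -` A \<inter> space m)"
    by (rule emeasure_distr) (simp add: A)
  then have "emeasure (distr m m (\<lambda>t. s + t)) A = emeasure m ((+) (- s) ` A)"
    by (simp only: translation_image minus_minus space_haar Int_UNIV_right)
  also have "\<dots> = emeasure m A" using haar A by (simp add: normalized_haar_measure_def)
  finally show "emeasure (distr m m (\<lambda>t. s + t)) A = emeasure m A" .
qed simp

lemma integral_translation:
  fixes h :: "'g \<Rightarrow> 'b::{banach, second_countable_topology}"
  assumes "h \<in> borel_measurable borel"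
  shows "(LINT t|m. h (s + t)) = (LINT t|m. h t)"
  using integral_distr[of "\<lambda>t. s + t" m m h] assms by (simp add: haar_translation)

lemma outer_regular_haar: "outer_regular m"
  unfolding outer_regular_def
proof (intro conjI ballI allI impI)
  fix A :: "'g set" and e :: real assume A: "A \<in> sets borel" and "e > 0"
  have "emeasure m A = (INF U \<in> {U. open U \<and> A \<subseteq> U}. emeasure m U)"
    using haar A unfolding normalized_haar_measure_def by blast
  moreover have "emeasure m A < emeasure m A + ennreal e"
    using \<open>e > 0\<close> by (simp add: emeasure_eq_measure ennreal_plus[symmetric] ennreal_less_iff del: ennreal_plus)
  ultimately obtain U where U: "open U" "A \<subseteq> U" "emeasure m U < emeasure m A + ennreal e"
    by (auto simp: INF_less_iff)
  then have "measure m U < measure m A + e"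
    using \<open>e > 0\<close> by (simp add: emeasure_eq_measure ennreal_plus[symmetric] ennreal_less_iff del: ennreal_plus)
  then have "measure m (U - A) < e" using A U by (subst finite_measure_Diff) auto
  then show "\<exists>U. open U \<and> A \<subseteq> U \<and> measure m (U - A) < e" using U by blast
qed (auto intro: finite_measure_axioms)

lemma outer_regular_haar_inverse: "outer_regular (distr m borel uminus)"
  unfolding outer_regular_def
proof (intro conjI ballI allI impI)
  show "finite_measure (distr m borel uminus)" by (rule finite_measure_distr) simp
  fix A :: "'g set" and e :: real assume A: "A \<in> sets borel" and "e > 0"
  have A': "uminus -` A \<in> sets borel"
    using measurable_sets[OF measurable_translation(3) A] by simp
  obtain U where U: "open U" "uminus -` A \<subseteq> U" "measure m (U - uminus -` A) < e"
    using outer_regular_haar A' \<open>e > 0\<close> unfolding outer_regular_def by blast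
  have o: "open (uminus -` U)" using U(1) by (intro open_vimage continuous_intros)
  moreover have "A \<subseteq> uminus -` U"
  proof
    fix x assume "x \<in> A"
    then have "- x \<in> uminus -` A" by simp
    then show "x \<in> uminus -` U" using U(2) by blast
  qed
  moreover have "measure (distr m borel uminus) (uminus -` U - A) < e"
    using U(3) A o by (subst measure_distr) (auto simp: vimage_Diff vimage_comp comp_def)
  ultimately show "\<exists>U. open U \<and> A \<subseteq> U \<and> measure (distr m borel uminus) (U - A) < e" by blast
qed simp

text \<open>The left translation \<open>s \<mapsto> t + s\<close> turns \<open>- s + t\<close> into \<open>- s\<close>, so the integral becomes one over the
image of \<open>m\<close> under inversion and is the same for all \<open>t\<close>.\<close>

lemma integral_reflected_translation:
  fixes h :: "'g \<Rightarrow> 'b::{banach, second_countable_topology}"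
  assumes [measurable]: "h \<in> borel_measurable borel"
  shows "(LINT s|m. h (- s + t)) = (LINT s|distr m borel uminus. h s)"
proof -
  have "(LINT s|m. h (- s + t)) = (LINT s|m. h (- (t + s) + t))"
    using integral_translation[of "\<lambda>s. h (- s + t)" t] by simp
  also have "\<dots> = (LINT s|m. h (- s))" by (simp add: minus_add add.assoc)
  also have "\<dots> = (LINT s|distr m borel uminus. h s)" by (subst integral_distr) auto
  finally show ?thesis .
qed

lemma integrable_bounded:
  fixes h :: "'g \<Rightarrow> 'b::{banach, second_countable_topology}"
  assumes "h \<in> borel_measurable borel" "\<And>t. norm (h t) \<le> B"
  shows "integrable m h"
  using assms by (intro integrable_const_bound[of _ B]) auto

lemma integrable_convolution_bounded:
  assumes f: "integrable m f" and g: "g \<in> borel_measurable borel" and B: "\<And>t. cmod (g t) \<le> B"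
  shows "integrable m (\<lambda>s. f s * g (- s + t))"
proof (rule Bochner_Integration.integrable_bound)
  show "integrable m (\<lambda>s. B * cmod (f s))" using f by simp
  have [measurable]: "f \<in> borel_measurable borel" "g \<in> borel_measurable borel"
    using f g borel_measurable_integrable by force+
  show "(\<lambda>s. f s * g (- s + t)) \<in> borel_measurable m" by simp
  have "B \<ge> 0" using B[of 0] norm_ge_zero order_trans by blast
  have "norm (f s * g (- s + t)) \<le> norm (B * cmod (f s))" for s
    using mult_left_mono[OF B[of "- s + t"], of "cmod (f s)"] \<open>B \<ge> 0\<close> by (simp add: norm_mult mult.commute)
  then show "AE s in m. norm (f s * g (- s + t)) \<le> norm (B * cmod (f s))" by simp
qed

lemma continuous_bounded:
  fixes c :: "'g \<Rightarrow> complex"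
  assumes "continuous_on UNIV c"
  obtains B where "\<And>t. cmod (c t) \<le> B"
proof -
  have "bounded (range c)" using compact_continuous_image[OF assms compact_UNIV] by (rule compact_imp_bounded)
  then show thesis using that unfolding bounded_iff by blast
qed

lemma convolution_continuous:
  assumes f: "integrable m f" and c: "continuous_on UNIV c"
  shows "continuous_on UNIV (group_convolution m f c)"
  unfolding continuous_on_def
proof (intro ballI tendstoI)
  fix t0 and e :: real assume "e > 0"
  obtain B where B: "\<And>t. cmod (c t) \<le> B" using continuous_bounded[OF c] by blast
  have cm: "c \<in> borel_measurable borel" by (rule borel_measurable_continuous_onI[OF c])
  define L where "L = (LINT s|m. cmod (f s)) + 1"
  have L: "L > 0" by (simp add: L_def add_nonneg_pos)
  have "e / L > 0" using \<open>e > 0\<close> L by simp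
  then obtain U where U: "open U" "0 \<in> U" "\<And>u x. u \<in> U \<Longrightarrow> cmod (c (x + u) - c x) \<le> e / L"
    using uniform_continuity_translation[OF compact_UNIV c] by metis
  have "open ((\<lambda>t. - t0 + t) -` U)" using U(1) by (intro open_vimage continuous_intros)
  then have "eventually (\<lambda>t. - t0 + t \<in> U) (at t0)"
    using U(2) by (intro eventually_at_in_open'[of "(\<lambda>t. - t0 + t) -` U", simplified]) auto
  then show "eventually (\<lambda>t. dist (group_convolution m f c t) (group_convolution m f c t0) < e) (at t0)"
  proof eventually_elim
    fix t assume t: "- t0 + t \<in> U"
    have "group_convolution m f c t - group_convolution m f c t0
        = (LINT s|m. f s * (c (- s + t) - c (- s + t0)))"
      unfolding group_convolution_def right_diff_distrib
      by (rule Bochner_Integration.integral_diff[symmetric]; rule integrable_convolution_bounded[OF f cm B])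
    also have "cmod \<dots> \<le> (LINT s|m. e / L * cmod (f s))"
    proof (rule norm_integral_le_integral)
      show "integrable m (\<lambda>s. f s * (c (- s + t) - c (- s + t0)))"
        unfolding right_diff_distrib
        by (rule Bochner_Integration.integrable_diff; rule integrable_convolution_bounded[OF f cm B])
      show "integrable m (\<lambda>s. e / L * cmod (f s))" using f by simp
      fix s
      have "cmod (c ((- s + t0) + (- t0 + t)) - c (- s + t0)) \<le> e / L" by (rule U(3)[OF t])
      then have "cmod (c (- s + t) - c (- s + t0)) \<le> e / L" by (simp add: add.assoc)
      then show "cmod (f s * (c (- s + t) - c (- s + t0))) \<le> e / L * cmod (f s)"
        unfolding norm_mult mult.commute[of "cmod (f s)"] by (rule mult_right_mono) simp
    qed
    also have "\<dots> = e / L * (L - 1)" by (simp add: L_def)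
    also have "\<dots> < e" using \<open>e > 0\<close> L by (simp add: field_simps)
    finally show "dist (group_convolution m f c t) (group_convolution m f c t0) < e" by (simp add: dist_norm)
  qed
qed

text \<open>For bounded \<open>f\<close> the convolution is continuous in its second factor, from \<open>L\<^sup>1\<close> of the inverted Haar
measure to the uniform norm. This pointwise bound takes the place of the estimate of
\<open>\<parallel>f * g\<parallel>\<^sub>1\<close> by Fubini's theorem.\<close>

lemma convolution_diff_le:
  assumes f: "f \<in> borel_measurable borel" "\<And>s. cmod (f s) \<le> F"
    and g: "g \<in> borel_measurable borel" "\<And>s. cmod (g s) \<le> B"
    and c: "c \<in> borel_measurable borel" "\<And>s. cmod (c s) \<le> B'"
  shows "cmod (group_convolution m f g t - group_convolution m f c t)
    \<le> F * (LINT s|distr m borel uminus. cmod (g s - c s))"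
proof -
  note [measurable] = f(1) g(1) c(1)
  have intf: "integrable m f" by (rule integrable_bounded[OF f])
  have "group_convolution m f g t - group_convolution m f c t
      = (LINT s|m. f s * (g (- s + t) - c (- s + t)))"
    unfolding group_convolution_def right_diff_distrib
    by (intro Bochner_Integration.integral_diff[symmetric] integrable_convolution_bounded[OF intf g]
          integrable_convolution_bounded[OF intf c])
  also have "cmod \<dots> \<le> (LINT s|m. F * cmod (g (- s + t) - c (- s + t)))"
  proof (rule norm_integral_le_integral)
    show "integrable m (\<lambda>s. f s * (g (- s + t) - c (- s + t)))"
      unfolding right_diff_distrib
      by (intro Bochner_Integration.integrable_diff integrable_convolution_bounded[OF intf g]
          integrable_convolution_bounded[OF intf c])
    show "integrable m (\<lambda>s. F * cmod (g (- s + t) - c (- s + t)))"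
    proof (intro integrable_mult_right integrable_bounded[of _ "B + B'"])
      show "norm (cmod (g (- s + t) - c (- s + t))) \<le> B + B'" for s
        using norm_triangle_ineq4[of "g (- s + t)" "c (- s + t)"] g(2)[of "- s + t"] c(2)[of "- s + t"] by simp
    qed measurable
  qed (simp add: norm_mult f(2) mult_right_mono)
  also have "\<dots> = F * (LINT s|distr m borel uminus. cmod (g s - c s))"
    using integral_reflected_translation[of "\<lambda>x. cmod (g x - c x)" t] by simp
  finally show ?thesis .
qed

text \<open>The convolution with a continuous function is continuous, and for bounded \<open>g\<close> it is a uniform limit
of such functions. This detour is needed because the integrand, as a function of both variables,
need not be measurable for the product \<open>\<sigma>\<close>-algebra.\<close>

lemma convolution_measurable_bounded:
  assumes f: "f \<in> borel_measurable borel" "\<And>s. cmod (f s) \<le> F"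
    and g: "g \<in> borel_measurable borel" "\<And>s. cmod (g s) \<le> B"
  shows "group_convolution m f g \<in> borel_measurable borel"
proof -
  have "\<exists>c. continuous_on UNIV c \<and> (LINT t|distr m borel uminus. cmod (g t - c t)) \<le> 1 / Suc n" for n
  proof -
    have "(1::real) / Suc n > 0" by simp
    from L1_continuous_approximation[OF compact_UNIV outer_regular_haar outer_regular_haar_inverse g this]
    show ?thesis by blast
  qed
  then obtain c where c: "\<And>n. continuous_on UNIV (c n)"
    "\<And>n. (LINT t|distr m borel uminus. cmod (g t - c n t)) \<le> 1 / Suc n" by metis
  have F: "F \<ge> 0" using f(2)[of 0] norm_ge_zero order_trans by blast
  show ?thesis
  proof (rule borel_measurable_LIMSEQ_metric)
    show "group_convolution m f (c n) \<in> borel_measurable borel" for n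
      by (intro borel_measurable_continuous_onI convolution_continuous integrable_bounded[OF f] c(1))
    fix t
    have le: "dist (group_convolution m f (c n) t) (group_convolution m f g t) \<le> F * (1 / Suc n)" for n
    proof -
      obtain B' where "\<And>t. cmod (c n t) \<le> B'" using continuous_bounded[OF c(1)] by blast
      from convolution_diff_le[OF f g borel_measurable_continuous_onI[OF c(1)] this]
      have "dist (group_convolution m f g t) (group_convolution m f (c n) t)
          \<le> F * (LINT s|distr m borel uminus. cmod (g s - c n s))" by (simp add: dist_norm)
      also have "\<dots> \<le> F * (1 / Suc n)" by (intro mult_left_mono c(2) F)
      finally show ?thesis by (simp add: dist_commute)
    qed
    have "(\<lambda>n. F * (1 / real (Suc n))) \<longlonglongrightarrow> F * 0"
      by (intro tendsto_intros LIMSEQ_Suc[OF lim_1_over_n])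
    then have lim: "(\<lambda>n. F * (1 / real (Suc n))) \<longlonglongrightarrow> 0" by simp
    show "(\<lambda>n. group_convolution m f (c n) t) \<longlonglongrightarrow> group_convolution m f g t"
    proof (rule metric_tendsto_imp_tendsto[OF lim], rule always_eventually, rule allI)
      fix n
      have "dist (F * (1 / real (Suc n))) 0 = F * (1 / real (Suc n))"
        using F by (simp add: dist_real_def)
      then show "dist (group_convolution m f (c n) t) (group_convolution m f g t)
          \<le> dist (F * (1 / real (Suc n))) 0" using le[of n] by (simp only:)
    qed
  qed
qed

end

context compact_haar
begin

lemma finite_cover_translates:
  fixes U :: "'g set"
  assumes U: "open U" "0 \<in> U"
  obtains xs :: "'g list" where "(\<Union>i<length xs. (+) (xs ! i) ` U) = UNIV"
proof -
  have op: "open ((+) s ` U)" for s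
    unfolding translation_image using U(1) by (intro open_vimage continuous_intros)
  have "t \<in> (+) t ` U" for t using U(2) by (intro image_eqI[of _ _ 0]) auto
  then have cov: "UNIV \<subseteq> (\<Union>s\<in>UNIV. (+) s ` U)" by blast
  obtain T where "T \<subseteq> UNIV" and T: "finite T" "UNIV \<subseteq> (\<Union>s\<in>T. (+) s ` U)"
    by (rule compactE_image[OF compact_UNIV op cov])
  obtain xs where xs: "set xs = T" using finite_list[OF T(1)] by blast
  have "(\<Union>i<length xs. (+) (xs ! i) ` U) = (\<Union>s\<in>set xs. (+) s ` U)"
    unfolding set_conv_nth by auto
  then have "(\<Union>i<length xs. (+) (xs ! i) ` U) = UNIV" using T(2) xs by (metis top.extremum_uniqueI)
  then show thesis by (rule that)
qed

text \<open>Partition the group into Borel sets \<open>E i\<close> on which \<open>- s + t\<close> varies so little that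
\<open>c (- s + t)\<close> is within \<open>d\<close> of \<open>c (- x\<^sub>i + t)\<close> for all \<open>t\<close>, where \<open>c\<close> is continuous and close to
\<open>g\<close>, and put \<open>a\<^sub>i = \<integral>\<^bsub>E i\<^esub> f\<close>. The error has three parts: \<open>f * (g - c)\<close>, which is uniformly small;
the discretization of \<open>f * c\<close>, also uniformly small; and \<open>\<Sum> a\<^sub>i \<tau>\<^bsub>x\<^sub>i\<^esub> (c - g)\<close>, which is small in
\<open>L\<^sup>1\<close> by translation invariance.\<close>

lemma convolution_approximation_by_translates:
  assumes f: "f \<in> borel_measurable borel" "\<And>s. cmod (f s) \<le> F"
    and g: "g \<in> borel_measurable borel" "\<And>s. cmod (g s) \<le> B" and "e > 0"
  shows "\<exists>(n::nat) a x. (\<Sum>i<n. cmod (a i)) \<le> (LINT s|m. cmod (f s)) \<and>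
    (LINT t|m. cmod (group_convolution m f g t - (\<Sum>i<n. a i * translate (x i) g t))) \<le> e"
proof -
  define L where "L = (LINT s|m. cmod (f s))"
  have F: "F \<ge> 0" using f(2)[of 0] norm_ge_zero order_trans by blast
  have L: "L \<ge> 0" by (simp add: L_def)
  have intf: "integrable m f" by (rule integrable_bounded[OF f])
  \<comment> \<open>The three parts of the error are at most \<open>F d\<close>, \<open>L d\<close> (both uniformly) and \<open>L d\<close> (in \<open>L\<^sup>1\<close>);
    the summand 1 only keeps the denominator positive.\<close>
  define d where "d = e / (F * measure m UNIV + L * measure m UNIV + L + 1)"
  have den: "F * measure m UNIV + L * measure m UNIV + L + 1 > 0"
    using F L by (simp add: add_nonneg_pos)
  have d: "d > 0" using \<open>e > 0\<close> den by (simp add: d_def)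
  obtain c where c: "continuous_on UNIV c" "(LINT t|m. cmod (g t - c t)) \<le> d"
      "(LINT t|distr m borel uminus. cmod (g t - c t)) \<le> d"
    using L1_continuous_approximation[OF compact_UNIV outer_regular_haar outer_regular_haar_inverse g d] by blast
  obtain C where C: "\<And>t. cmod (c t) \<le> C" using continuous_bounded[OF c(1)] by blast
  have cm: "c \<in> borel_measurable borel" by (rule borel_measurable_continuous_onI[OF c(1)])
  note [measurable] = f(1) g(1) cm
  obtain U where U: "open U" "0 \<in> U" "\<And>u x. u \<in> U \<Longrightarrow> cmod (c (- u + x) - c x) \<le> d"
    using uniform_continuity_translation[OF compact_UNIV c(1) d] by metis
  obtain xs where xs: "(\<Union>i<length xs. (+) (xs ! i) ` U) = UNIV"
    using finite_cover_translates[OF U(1,2)] by blast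
  define n where "n = length xs"
  define V where "V i = (if i < n then (+) (xs ! i) ` U else {})" for i
  define E where "E i = disjointed V i" for i
  have V: "V i \<in> sets borel" for i using U(1) by (auto simp: V_def intro: sets_translation_image)
  then have E: "E i \<in> sets borel" for i
    using sets.range_disjointed_sets[of V borel] by (auto simp: E_def)
  have UNE: "(\<Union>i<n. E i) = UNIV"
  proof -
    have "(\<Union>i. V i) = (\<Union>i<n. (+) (xs ! i) ` U)" by (fastforce simp: V_def split: if_splits)
    then have "(\<Union>i. E i) = UNIV" unfolding E_def UN_disjointed_eq using xs by (simp only: n_def)
    moreover have "E i = {}" if "i \<ge> n" for i
      using disjointed_subset[of V i] that by (auto simp: E_def V_def)
    ultimately show ?thesis using not_less by blast
  qed
  have disj: "i = j" if "s \<in> E i" "s \<in> E j" for s i j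
    using that disjoint_family_disjointed[of V] by (auto simp: E_def disjoint_family_on_def)
  have one: "(\<Sum>i<n. indicator (E i) s * z i) = z j" if "j < n" "s \<in> E j" for s j and z :: "nat \<Rightarrow> 'b::real_normed_field"
  proof -
    have "(\<Sum>i<n. indicator (E i) s * z i) = (\<Sum>i<n. if i = j then z j else 0)"
      using that disj by (intro sum.cong) (auto simp: indicator_def)
    then show ?thesis using that(1) by simp
  qed
  define a where "a i = (LINT s|m. indicator (E i) s * f s)" for i
  have intE: "integrable m (\<lambda>s. indicator (E i) s * h s)"
    if "integrable m h" for i and h :: "'g \<Rightarrow> 'b::{real_normed_field, banach, second_countable_topology}"
  proof (rule Bochner_Integration.integrable_bound[OF that])
    note [measurable] = E
    have [measurable]: "h \<in> borel_measurable borel" using borel_measurable_integrable[OF that] by simp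
    show "(\<lambda>s. indicator (E i) s * h s) \<in> borel_measurable m" by simp
  qed (auto simp: indicator_def)
  have sum_a: "(\<Sum>i<n. cmod (a i)) \<le> L"
  proof -
    have "(\<Sum>i<n. cmod (a i)) \<le> (\<Sum>i<n. (LINT s|m. indicator (E i) s * cmod (f s)))"
      unfolding a_def
      using intf by (intro sum_mono norm_integral_le_integral intE) (auto simp: norm_mult indicator_def)
    also have "\<dots> = (LINT s|m. (\<Sum>i<n. indicator (E i) s * cmod (f s)))"
      using intf by (intro Bochner_Integration.integral_sum[symmetric] intE) auto
    also have "\<dots> = L"
      unfolding L_def
    proof (rule Bochner_Integration.integral_cong[OF refl])
      fix s
      obtain j where "j < n" "s \<in> E j" using UNE by blast
      from one[OF this, of "\<lambda>_. cmod (f s)"]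
      show "(\<Sum>i<n. indicator (E i) s * cmod (f s)) = cmod (f s)" .
    qed
    finally show ?thesis .
  qed
  have cont: "cmod (group_convolution m f c t - (\<Sum>i<n. a i * c (- (xs ! i) + t))) \<le> d * L" for t
  proof -
    have intc: "integrable m (\<lambda>s. f s * c (- s + t))" by (rule integrable_convolution_bounded[OF intf cm C])
    have intS: "integrable m (\<lambda>s. \<Sum>i<n. indicator (E i) s * (f s * c (- (xs ! i) + t)))"
      using intf by (intro Bochner_Integration.integrable_sum intE) auto
    have "(\<Sum>i<n. a i * c (- (xs ! i) + t)) = (LINT s|m. (\<Sum>i<n. indicator (E i) s * (f s * c (- (xs ! i) + t))))"
    proof (subst Bochner_Integration.integral_sum)
      show "integrable m (\<lambda>s. indicator (E i) s * (f s * c (- (xs ! i) + t)))" for i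
        using intf by (intro intE) auto
      show "(\<Sum>i<n. a i * c (- (xs ! i) + t)) = (\<Sum>i<n. LINT s|m. indicator (E i) s * (f s * c (- (xs ! i) + t)))"
        unfolding a_def mult.assoc[symmetric] by simp
    qed
    then have "group_convolution m f c t - (\<Sum>i<n. a i * c (- (xs ! i) + t))
        = (LINT s|m. f s * c (- s + t) - (\<Sum>i<n. indicator (E i) s * (f s * c (- (xs ! i) + t))))"
      unfolding group_convolution_def using intc intS by simp
    also have "cmod \<dots> \<le> (LINT s|m. d * cmod (f s))"
    proof (rule norm_integral_le_integral)
      show "integrable m (\<lambda>s. f s * c (- s + t) - (\<Sum>i<n. indicator (E i) s * (f s * c (- (xs ! i) + t))))"
        using intc intS by (rule Bochner_Integration.integrable_diff)
      show "integrable m (\<lambda>s. d * cmod (f s))" using intf by simp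
      fix s
      obtain j where j: "j < n" "s \<in> E j" using UNE by blast
      have "s \<in> V j" using j(2) disjointed_subset[of V j] by (auto simp: E_def)
      then obtain u where u: "u \<in> U" "s = xs ! j + u" using j(1) by (auto simp: V_def)
      have "- s + t = - u + (- (xs ! j) + t)" by (simp only: u(2) minus_add add.assoc)
      then have le: "cmod (c (- s + t) - c (- (xs ! j) + t)) \<le> d" using U(3)[OF u(1)] by simp
      have "f s * c (- s + t) - (\<Sum>i<n. indicator (E i) s * (f s * c (- (xs ! i) + t)))
          = f s * (c (- s + t) - c (- (xs ! j) + t))"
        unfolding one[OF j] by (simp add: right_diff_distrib)
      then show "cmod (f s * c (- s + t) - (\<Sum>i<n. indicator (E i) s * (f s * c (- (xs ! i) + t)))) \<le> d * cmod (f s)"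
        using mult_left_mono[OF le, of "cmod (f s)"] by (simp add: norm_mult mult.commute)
    qed
    finally show ?thesis by (simp add: L_def)
  qed
  let ?S = "\<lambda>t. \<Sum>i<n. a i * translate (xs ! i) g t"
  have pt: "cmod (group_convolution m f g t - ?S t)
      \<le> F * d + d * L + (\<Sum>i<n. cmod (a i) * cmod (g (- (xs ! i) + t) - c (- (xs ! i) + t)))" for t
  proof -
    have 1: "cmod (group_convolution m f g t - group_convolution m f c t) \<le> F * d"
      using convolution_diff_le[OF f g cm C, of t] mult_left_mono[OF c(3) F] by linarith
    have 3: "cmod ((\<Sum>i<n. a i * c (- (xs ! i) + t)) - ?S t)
        \<le> (\<Sum>i<n. cmod (a i) * cmod (g (- (xs ! i) + t) - c (- (xs ! i) + t)))"
      unfolding sum_subtractf[symmetric] right_diff_distrib[symmetric] translate_def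
      by (intro order_trans[OF norm_sum] sum_mono) (simp add: norm_mult norm_minus_commute)
    have "cmod (group_convolution m f g t - ?S t)
        \<le> cmod (group_convolution m f g t - group_convolution m f c t)
          + cmod (group_convolution m f c t - (\<Sum>i<n. a i * c (- (xs ! i) + t)))
          + cmod ((\<Sum>i<n. a i * c (- (xs ! i) + t)) - ?S t)"
      by (rule order_trans[OF _ add_right_mono[OF norm_triangle_ineq]],
          rule order_trans[OF _ norm_triangle_ineq]) simp
    then show ?thesis using 1 3 cont[of t] by linarith
  qed
  have intd: "integrable m (\<lambda>t. cmod (g (y + t) - c (y + t)))" for y
  proof (rule integrable_bounded[of _ "B + C"])
    show "norm (cmod (g (y + t) - c (y + t))) \<le> B + C" for t
      using norm_triangle_ineq4[of "g (y + t)" "c (y + t)"] g(2)[of "y + t"] C[of "y + t"] by simp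
  qed measurable
  have "(LINT t|m. cmod (group_convolution m f g t - ?S t))
      \<le> (LINT t|m. F * d + d * L + (\<Sum>i<n. cmod (a i) * cmod (g (- (xs ! i) + t) - c (- (xs ! i) + t))))"
  proof (rule integral_mono'[OF _ pt])
    show "integrable m (\<lambda>t. F * d + d * L + (\<Sum>i<n. cmod (a i) * cmod (g (- (xs ! i) + t) - c (- (xs ! i) + t))))"
      using intd by (intro Bochner_Integration.integrable_add Bochner_Integration.integrable_sum integrable_mult_right) auto
  qed (rule order_trans[OF norm_ge_zero pt])
  also have "\<dots> = (F * d + d * L) * measure m UNIV
      + (\<Sum>i<n. cmod (a i) * (LINT t|m. cmod (g (- (xs ! i) + t) - c (- (xs ! i) + t))))"
    using intd by (subst Bochner_Integration.integral_add) (auto simp: Bochner_Integration.integral_sum mult.commute)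
  also have "(\<lambda>i. LINT t|m. cmod (g (- (xs ! i) + t) - c (- (xs ! i) + t))) = (\<lambda>i. LINT t|m. cmod (g t - c t))"
    by (intro ext integral_translation[of "\<lambda>x. cmod (g x - c x)"]) measurable
  then have "(\<Sum>i<n. cmod (a i) * (LINT t|m. cmod (g (- (xs ! i) + t) - c (- (xs ! i) + t))))
      = (\<Sum>i<n. cmod (a i)) * (LINT t|m. cmod (g t - c t))"
    unfolding sum_distrib_right by (simp add: fun_eq_iff)
  also have "\<dots> \<le> L * d"
    using sum_a c(2) L by (intro mult_mono) auto
  also have "(F * d + d * L) * measure m UNIV + L * d
      \<le> d * (F * measure m UNIV + L * measure m UNIV + L + 1)"
    using d by (simp add: algebra_simps)
  also have "\<dots> = e" using den by (simp add: d_def)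
  finally have "(LINT t|m. cmod (group_convolution m f g t - ?S t)) \<le> e" by simp
  then show ?thesis
    by (intro exI[of _ n] exI[of _ a] exI[of _ "\<lambda>i. xs ! i"] conjI sum_a[unfolded L_def])
qed

text \<open>Pass to a subsequence of the approximating sums that converges almost everywhere for \<open>m\<close>, hence for
the variation of every \<open>x' \<circ> \<nu>\<close>, and apply Fatou's lemma. Each sum has norm at most
\<open>(\<Sum> \<bar>a\<^sub>i\<bar>) \<parallel>g\<parallel>\<close> by the triangle inequality and translation invariance.\<close>

lemma convolution_norm_bounded:
  fixes \<nu> :: "'g set \<Rightarrow> 'x::complex_banach"
  assumes \<Phi>: "young_function \<Phi>" and \<nu>: "vector_measure \<nu>" and ac: "abs_continuous m \<nu>"
    and inv: "norm_integral_translation_invariant \<nu>"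
    and f: "f \<in> borel_measurable borel" "\<And>s. cmod (f s) \<le> F"
    and g: "g \<in> borel_measurable borel" "\<And>s. cmod (g s) \<le> B"
  shows "orlicz_norm \<nu> \<Phi> (group_convolution m f g)
    \<le> ennreal (LINT s|m. cmod (f s)) * orlicz_norm \<nu> \<Phi> g"
proof -
  note [measurable] = g(1) convolution_measurable_bounded[OF f g]
  define D where "D a (x :: nat \<Rightarrow> 'g) n t = group_convolution m f g t - (\<Sum>i<n. a i * translate (x i) g t)"
    for a x n t
  define Q where "Q k n a x \<longleftrightarrow> (\<Sum>i<n. cmod (a i)) \<le> (LINT s|m. cmod (f s))
      \<and> (LINT t|m. cmod (D a x n t)) \<le> 1 / Suc k" for k n a x
  have "\<exists>n a x. Q k n a x" for k
  proof -
    have "(1::real) / Suc k > 0" by simp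
    from convolution_approximation_by_translates[OF f g this]
    show ?thesis unfolding Q_def D_def .
  qed
  then obtain n a x where "\<And>k. Q k (n k) (a k) (x k)" by metis
  then have nax: "\<And>k. (\<Sum>i<n k. cmod (a k i)) \<le> (LINT s|m. cmod (f s))"
      "\<And>k. (LINT t|m. cmod (D (a k) (x k) (n k) t)) \<le> 1 / Suc k"
    unfolding Q_def by blast+
  define S where "S k t = (\<Sum>i<n k. a k i * translate (x k i) g t)" for k t
  have tm [measurable]: "translate s g \<in> borel_measurable borel" for s
    unfolding translate_def by measurable
  have [measurable]: "S k \<in> borel_measurable borel" for k
    unfolding S_def by measurable
  have D: "D (a k) (x k) (n k) = (\<lambda>t. group_convolution m f g t - S k t)" for k
    by (simp add: D_def S_def fun_eq_iff)
  have bS: "cmod (S k t) \<le> (LINT s|m. cmod (f s)) * B" for k t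
  proof -
    have "cmod (S k t) \<le> (\<Sum>i<n k. cmod (a k i) * B)"
      unfolding S_def translate_def
      by (intro order_trans[OF norm_sum] sum_mono) (simp add: norm_mult mult_left_mono g(2))
    also have "\<dots> \<le> (LINT s|m. cmod (f s)) * B"
      unfolding sum_distrib_right[symmetric] using order_trans[OF norm_ge_zero g(2)]
      by (intro mult_right_mono nax) blast
    finally show ?thesis .
  qed
  have intf: "integrable m f" by (rule integrable_bounded[OF f])
  have bC: "cmod (group_convolution m f g t) \<le> (LINT s|m. cmod (f s)) * B" for t
  proof -
    have "cmod (group_convolution m f g t) \<le> (LINT s|m. cmod (f s) * B)"
      unfolding group_convolution_def
    proof (rule norm_integral_le_integral[OF integrable_convolution_bounded[OF intf g]])
      show "integrable m (\<lambda>s. cmod (f s) * B)" using intf by simp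
    qed (simp add: norm_mult mult_left_mono g(2))
    then show ?thesis by simp
  qed
  have "integrable m (D (a k) (x k) (n k))" for k
    unfolding D using norm_triangle_le_diff[OF add_mono[OF bC bS]]
    by (intro integrable_bounded) auto
  moreover have "(\<lambda>k. LINT t|m. cmod (D (a k) (x k) (n k) t)) \<longlonglongrightarrow> 0"
  proof (rule tendsto_sandwich[OF _ _ tendsto_const LIMSEQ_Suc[OF lim_1_over_n]])
    show "\<forall>\<^sub>F k in sequentially. 0 \<le> (LINT t|m. cmod (D (a k) (x k) (n k) t))" by simp
  qed (use nax(2) in auto)
  ultimately obtain r where r: "strict_mono (r :: nat \<Rightarrow> nat)"
      "AE t in m. (\<lambda>k. D (a (r k)) (x (r k)) (n (r k)) t) \<longlonglongrightarrow> 0"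
    using tendsto_L1_AE_subseq[of m "\<lambda>k. D (a k) (x k) (n k)"] by blast
  have "AE t in m. (\<lambda>k. S (r k) t) \<longlonglongrightarrow> group_convolution m f g t"
    using r(2)
  proof eventually_elim
    fix t assume "(\<lambda>k. D (a (r k)) (x (r k)) (n (r k)) t) \<longlonglongrightarrow> 0"
    from tendsto_diff[OF tendsto_const[of "group_convolution m f g t"] this]
    show "(\<lambda>k. S (r k) t) \<longlonglongrightarrow> group_convolution m f g t" by (simp add: D)
  qed
  note AE = AE_variation_measure[OF \<nu> ac _ sets_haar this]
  show ?thesis
  proof (rule orlicz_fatou[OF \<Phi>, where u = "\<lambda>k. S (r k)"])
    show "AE t in variation_measure (\<lambda>A. x' (\<nu> A)). group_convolution m f g t = 0
        \<or> (\<lambda>k. S (r k) t) \<longlonglongrightarrow> group_convolution m f g t" if "x' \<in> dual_unit_ball" for x'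
      using AE[OF that] by eventually_elim simp
    show "orlicz_norm \<nu> \<Phi> (S (r k)) \<le> ennreal (LINT s|m. cmod (f s)) * orlicz_norm \<nu> \<Phi> g" for k
    proof -
      have "orlicz_norm \<nu> \<Phi> (S (r k)) \<le> ennreal (\<Sum>i<n (r k). cmod (a (r k) i)) * orlicz_norm \<nu> \<Phi> g"
        unfolding S_def using g(1)
        by (intro orlicz_linear_combination[OF \<Phi>] orlicz_norm_translate_le[OF \<Phi> \<nu> inv] tm) auto
      also have "\<dots> \<le> ennreal (LINT s|m. cmod (f s)) * orlicz_norm \<nu> \<Phi> g"
        by (intro mult_right_mono ennreal_leI nax) auto
      finally show ?thesis .
    qed
  qed simp
qed

text \<open>The neutral element has a neighbourhood \<open>U\<close> with \<open>m (U - {0})\<close> so small that \<open>\<nu>\<close> is below 1 on its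
subsets. The point itself is left out because Haar measure has atoms when the group is finite.
Finitely many translates of \<open>U\<close> cover the group, and each contributes at most 1 plus the value of
\<open>\<nu>\<close> at one point.\<close>

lemma vector_measure_bounded:
  fixes \<nu> :: "'g set \<Rightarrow> 'x::real_normed_vector"
  assumes \<nu>: "vector_measure \<nu>" and ac: "abs_continuous m \<nu>"
  obtains B where "B \<ge> 0" "\<And>A. A \<in> sets borel \<Longrightarrow> norm (\<nu> A) \<le> B"
proof -
  obtain \<delta> where \<delta>: "\<delta> > 0" "\<And>A. A \<in> sets borel \<Longrightarrow> measure m A < \<delta> \<Longrightarrow> norm (\<nu> A) < 1"
    using ac zero_less_one unfolding abs_continuous_def by metis
  obtain U where U: "open U" "{0} \<subseteq> U" "measure m (U - {0}) < \<delta>"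
    using outer_regular_haar \<delta>(1) borel_singleton[of "{}"] unfolding outer_regular_def by (metis sets.empty_sets)
  have "open U" "0 \<in> U" using U by auto
  then obtain xs where xs: "(\<Union>i<length xs. (+) (xs ! i) ` U) = UNIV" by (rule finite_cover_translates)
  have small: "norm (\<nu> A) \<le> norm (\<nu> {s}) + 1" if A: "A \<in> sets borel" "A \<subseteq> (+) s ` U" for A s
  proof -
    have "A - {s} \<subseteq> (+) s ` (U - {0})"
    proof
      fix x assume x: "x \<in> A - {s}"
      then obtain u where "u \<in> U" "x = s + u" using A(2) by blast
      with x show "x \<in> (+) s ` (U - {0})" by (intro image_eqI[of _ _ u]) auto
    qed
    then have "measure m (A - {s}) \<le> measure m ((+) s ` (U - {0}))"
      using U(1) by (intro finite_measure_mono) (auto intro!: sets_translation_image)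
    also have "\<dots> = measure m (U - {0})"
      using haar U(1) by (simp add: measure_def normalized_haar_measure_def)
    finally have 1: "norm (\<nu> (A - {s})) < 1" using U(3) A(1) by (intro \<delta>(2)) auto
    have "A \<inter> {s} \<inter> (A - {s}) = {}" by blast
    then have "\<nu> A = \<nu> (A \<inter> {s}) + \<nu> (A - {s})"
      using vector_measure_Un[OF \<nu>, of "A \<inter> {s}" "A - {s}"] A(1) by (simp add: Int_Diff_Un) 
    moreover have "norm (\<nu> (A \<inter> {s})) \<le> norm (\<nu> {s})"
      by (cases "s \<in> A") (simp_all add: normed_vector_measure_empty[OF \<nu>])
    ultimately show ?thesis using 1 norm_triangle_ineq[of "\<nu> (A \<inter> {s})" "\<nu> (A - {s})"] by simp
  qed
  have "norm (\<nu> A) \<le> (\<Sum>i<k. norm (\<nu> {xs ! i}) + 1)"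
    if "A \<in> sets borel" "A \<subseteq> (\<Union>i<k. (+) (xs ! i) ` U)" for A k
    using that
  proof (induction k arbitrary: A)
    case 0
    then show ?case by (simp add: normed_vector_measure_empty[OF \<nu>])
  next
    case (Suc k)
    let ?V = "(+) (xs ! k) ` U"
    have V: "?V \<in> sets borel" using U(1) by (intro sets_translation_image) auto
    have "A \<inter> ?V \<inter> (A - ?V) = {}" by blast
    then have "\<nu> A = \<nu> (A \<inter> ?V) + \<nu> (A - ?V)"
      using vector_measure_Un[OF \<nu>, of "A \<inter> ?V" "A - ?V"] Suc.prems(1) V by (simp add: Int_Diff_Un Int_Diff)
    then have "norm (\<nu> A) \<le> norm (\<nu> (A \<inter> ?V)) + norm (\<nu> (A - ?V))" by (simp add: norm_triangle_ineq)
    also have "norm (\<nu> (A \<inter> ?V)) \<le> norm (\<nu> {xs ! k}) + 1"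
      using Suc.prems(1) V by (intro small) auto
    also have "norm (\<nu> (A - ?V)) \<le> (\<Sum>i<k. norm (\<nu> {xs ! i}) + 1)"
      using Suc.prems V by (intro Suc.IH) (auto simp: lessThan_Suc)
    finally show ?case by simp
  qed
  from this[of _ "length xs"] show thesis
    using xs by (intro that[of "\<Sum>i<length xs. norm (\<nu> {xs ! i}) + 1"]) (auto intro!: sum_nonneg)
qed

end

section \<open>Convolution of integrable functions\<close>

definition truncation :: "nat \<Rightarrow> ('a \<Rightarrow> complex) \<Rightarrow> 'a \<Rightarrow> complex" where
  "truncation n h t = (if cmod (h t) \<le> real n then h t else 0)"

lemma truncation_le: "cmod (truncation n h t) \<le> real n" "cmod (truncation n h t) \<le> cmod (h t)"
  by (auto simp: truncation_def)

lemma truncation_measurable [measurable]: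
  assumes [measurable]: "h \<in> borel_measurable M"
  shows "truncation n h \<in> borel_measurable M"
  unfolding truncation_def[abs_def] by measurable

lemma truncation_tendsto: "(\<lambda>n. truncation n h t) \<longlonglongrightarrow> h t"
proof (rule tendsto_eventually)
  obtain N where "cmod (h t) \<le> real N" using real_arch_simple by blast
  then show "\<forall>\<^sub>F n in sequentially. truncation n h t = h t"
    unfolding eventually_sequentially by (intro exI[of _ N]) (auto simp: truncation_def)
qed

lemma truncation_mono: "i \<le> j \<Longrightarrow> cmod (truncation i h t) \<le> cmod (truncation j h t)"
  by (auto simp: truncation_def)

text \<open>Moduli are kept complex-valued so that the results on complex convolutions apply to them.\<close>

abbreviation abs_truncation :: "nat \<Rightarrow> ('a \<Rightarrow> complex) \<Rightarrow> 'a \<Rightarrow> complex" where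
  "abs_truncation n h \<equiv> \<lambda>t. complex_of_real (cmod (truncation n h t))"

context compact_haar
begin

lemma integrable_truncations:
  assumes [measurable]: "f \<in> borel_measurable borel" "g \<in> borel_measurable borel"
  shows "integrable m (\<lambda>s. cmod (truncation n f s) * cmod (truncation n g (- s + t)))"
  by (rule integrable_bounded[of _ "real n * real n"])
    (auto simp: abs_mult intro!: mult_mono truncation_le)

lemma cmod_abs_truncation_convolution:
  assumes "f \<in> borel_measurable borel" "g \<in> borel_measurable borel"
  shows "cmod (group_convolution m (abs_truncation n f) (abs_truncation n g) t)
    = (LINT s|m. cmod (truncation n f s) * cmod (truncation n g (- s + t)))"
  unfolding group_convolution_def of_real_mult[symmetric] integral_complex_of_real
  by simp

text \<open>Monotone control of the truncated absolute convolutions describes the points at which the convolution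
integral converges through countably many functions whose measurability is known.\<close>

lemma convolution_integrable_iff:
  assumes [measurable]: "f \<in> borel_measurable borel" "g \<in> borel_measurable borel"
  shows "integrable m (\<lambda>s. f s * g (- s + t)) \<longleftrightarrow>
    (\<exists>B. \<forall>n. cmod (group_convolution m (abs_truncation n f) (abs_truncation n g) t) \<le> B)"
proof
  assume int: "integrable m (\<lambda>s. f s * g (- s + t))"
  have "cmod (group_convolution m (abs_truncation n f) (abs_truncation n g) t)
      \<le> (LINT s|m. cmod (f s * g (- s + t)))" for n
    unfolding cmod_abs_truncation_convolution[OF assms]
    using integrable_norm[OF int] by (intro integral_mono integrable_truncations)
      (auto simp: norm_mult intro!: mult_mono truncation_le)
  then show "\<exists>B. \<forall>n. cmod (group_convolution m (abs_truncation n f) (abs_truncation n g) t) \<le> B" by blast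
next
  assume "\<exists>B. \<forall>n. cmod (group_convolution m (abs_truncation n f) (abs_truncation n g) t) \<le> B"
  then obtain B where B: "\<And>n. (LINT s|m. cmod (truncation n f s) * cmod (truncation n g (- s + t))) \<le> B"
    unfolding cmod_abs_truncation_convolution[OF assms] by blast
  let ?u = "\<lambda>n s. ennreal (cmod (truncation n f s) * cmod (truncation n g (- s + t)))"
  have "(\<integral>\<^sup>+ s. ennreal (cmod (f s * g (- s + t))) \<partial>m) = (\<integral>\<^sup>+ s. liminf (\<lambda>n. ?u n s) \<partial>m)"
  proof (rule nn_integral_cong)
    fix s
    have "(\<lambda>n. ?u n s) \<longlonglongrightarrow> ennreal (cmod (f s) * cmod (g (- s + t)))"
      by (intro tendsto_ennrealI tendsto_intros truncation_tendsto)
    then have "liminf (\<lambda>n. ?u n s) = ennreal (cmod (f s) * cmod (g (- s + t)))"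
      by (intro lim_imp_Liminf) simp
    then show "ennreal (cmod (f s * g (- s + t))) = liminf (\<lambda>n. ?u n s)"
      by (simp only: norm_mult)
  qed
  also have "\<dots> \<le> liminf (\<lambda>n. \<integral>\<^sup>+ s. ?u n s \<partial>m)"
    by (rule nn_integral_liminf) simp
  also have "\<dots> \<le> liminf (\<lambda>n::nat. ennreal B)"
  proof (intro Liminf_mono always_eventually allI)
    fix n
    have "(\<integral>\<^sup>+ s. ?u n s \<partial>m) = ennreal (LINT s|m. cmod (truncation n f s) * cmod (truncation n g (- s + t)))"
      by (intro nn_integral_eq_integral integrable_truncations) auto
    then show "(\<integral>\<^sup>+ s. ?u n s \<partial>m) \<le> ennreal B" using B by (simp add: ennreal_leI)
  qed
  also have "\<dots> < \<infinity>" by (simp add: Liminf_const)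
  finally show "integrable m (\<lambda>s. f s * g (- s + t))" by (intro integrableI_bounded) auto
qed

lemma truncated_convolution_tendsto:
  assumes [measurable]: "f \<in> borel_measurable borel" "g \<in> borel_measurable borel"
    and int: "integrable m (\<lambda>s. f s * g (- s + t))"
  shows "(\<lambda>n. group_convolution m (truncation n f) (truncation n g) t) \<longlonglongrightarrow> group_convolution m f g t"
  unfolding group_convolution_def
proof (rule integral_dominated_convergence)
  show "integrable m (\<lambda>s. cmod (f s * g (- s + t)))" using int by simp
  show "AE s in m. (\<lambda>n. truncation n f s * truncation n g (- s + t)) \<longlonglongrightarrow> f s * g (- s + t)"
    by (intro AE_I2 tendsto_intros truncation_tendsto)
  show "AE s in m. cmod (truncation n f s * truncation n g (- s + t)) \<le> cmod (f s * g (- s + t))" for n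
    by (intro AE_I2) (auto simp: norm_mult intro!: mult_mono truncation_le)
qed simp_all

text \<open>The Bochner integral of a function that is not integrable is 0.\<close>

lemma convolution_eq_0_or_tendsto:
  assumes "f \<in> borel_measurable borel" "g \<in> borel_measurable borel"
  shows "group_convolution m f g t = 0 \<or>
    (\<lambda>n. group_convolution m (truncation n f) (truncation n g) t) \<longlonglongrightarrow> group_convolution m f g t"
proof (cases "integrable m (\<lambda>s. f s * g (- s + t))")
  case False
  then show ?thesis by (simp add: group_convolution_def not_integrable_integral_eq)
qed (use truncated_convolution_tendsto assms in blast)

lemma truncated_convolution_measurable:
  assumes [measurable]: "f \<in> borel_measurable borel" "g \<in> borel_measurable borel"
  shows "group_convolution m (truncation n f) (truncation n g) \<in> borel_measurable borel"
    "group_convolution m (abs_truncation n f) (abs_truncation n g) \<in> borel_measurable borel"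
  by (rule convolution_measurable_bounded[of _ "real n" _ "real n"]; simp add: truncation_le)+

text \<open>The convolution is a pointwise limit of measurable functions on the measurable set where the
integral converges, and 0 elsewhere.\<close>

lemma convolution_measurable:
  assumes [measurable]: "f \<in> borel_measurable borel" "g \<in> borel_measurable borel"
  shows "group_convolution m f g \<in> borel_measurable borel"
proof -
  let ?P = "\<lambda>t. \<exists>k::nat. \<forall>n. cmod (group_convolution m (abs_truncation n f) (abs_truncation n g) t) \<le> real k"
  have iff: "integrable m (\<lambda>s. f s * g (- s + t)) \<longleftrightarrow> ?P t" for t
    unfolding convolution_integrable_iff[OF assms] by (meson order_trans real_arch_simple)
  have eq: "group_convolution m f g t
      = (if ?P t then lim (\<lambda>n. group_convolution m (truncation n f) (truncation n g) t) else 0)" for t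
  proof (cases "integrable m (\<lambda>s. f s * g (- s + t))")
    case True
    then show ?thesis
      using limI[OF truncated_convolution_tendsto[OF assms True]] iff[of t] by simp
  next
    case False
    then have "group_convolution m f g t = 0" by (simp add: group_convolution_def not_integrable_integral_eq)
    moreover have "\<not> ?P t" using False iff[of t] by blast
    ultimately show ?thesis by (simp only: if_False)
  qed
  have "(\<lambda>t. if ?P t then lim (\<lambda>n. group_convolution m (truncation n f) (truncation n g) t) else 0)
      \<in> borel_measurable borel"
    using truncated_convolution_measurable[OF assms] by measurable
  moreover have "group_convolution m f g
      = (\<lambda>t. if ?P t then lim (\<lambda>n. group_convolution m (truncation n f) (truncation n g) t) else 0)"
    by (rule ext) (rule eq)
  ultimately show ?thesis by (simp only:)
qed

lemma truncated_convolution_norm: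
  fixes \<nu> :: "'g set \<Rightarrow> 'x::complex_banach"
  assumes \<Phi>: "young_function \<Phi>" and \<nu>: "vector_measure \<nu>" and ac: "abs_continuous m \<nu>"
    and inv: "norm_integral_translation_invariant \<nu>"
    and f: "integrable m f" and g: "g \<in> borel_measurable borel"
  shows "orlicz_norm \<nu> \<Phi> (group_convolution m (truncation n f) (truncation n g))
      \<le> ennreal (LINT s|m. cmod (f s)) * orlicz_norm \<nu> \<Phi> g" (is ?A)
    and "orlicz_norm \<nu> \<Phi> (group_convolution m (abs_truncation n f) (abs_truncation n g))
      \<le> ennreal (LINT s|m. cmod (f s)) * orlicz_norm \<nu> \<Phi> g" (is ?B)
proof -
  have fm: "f \<in> borel_measurable borel" using borel_measurable_integrable[OF f] by simp
  note [measurable] = fm g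
  have *: "orlicz_norm \<nu> \<Phi> (group_convolution m f' g') \<le> ennreal (LINT s|m. cmod (f s)) * orlicz_norm \<nu> \<Phi> g"
    if [measurable]: "f' \<in> borel_measurable borel" "g' \<in> borel_measurable borel"
      and f': "\<And>t. cmod (f' t) = cmod (truncation n f t)" and g': "\<And>t. cmod (g' t) = cmod (truncation n g t)" for f' g'
  proof -
    have "orlicz_norm \<nu> \<Phi> (group_convolution m f' g') \<le> ennreal (LINT s|m. cmod (f' s)) * orlicz_norm \<nu> \<Phi> g'"
      using truncation_le(1) by (intro convolution_norm_bounded[OF \<Phi> \<nu> ac inv, of _ "real n" _ "real n"]) (auto simp: f' g')
    also have "\<dots> \<le> ennreal (LINT s|m. cmod (f s)) * orlicz_norm \<nu> \<Phi> g"
    proof (intro mult_mono ennreal_leI orlicz_mono[OF \<Phi>])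
      show "(LINT s|m. cmod (f' s)) \<le> (LINT s|m. cmod (f s))"
        using f by (intro integral_mono') (auto simp: f' truncation_le)
    qed (auto simp: g' truncation_le)
    finally show ?thesis .
  qed
  show ?A ?B by (intro *; simp)+
qed

lemma convolution_norm:
  fixes \<nu> :: "'g set \<Rightarrow> 'x::complex_banach"
  assumes \<Phi>: "young_function \<Phi>" and \<nu>: "vector_measure \<nu>" and ac: "abs_continuous m \<nu>"
    and inv: "norm_integral_translation_invariant \<nu>"
    and f: "integrable m f" and g: "g \<in> borel_measurable borel"
  shows "orlicz_norm \<nu> \<Phi> (group_convolution m f g) \<le> ennreal (LINT s|m. cmod (f s)) * orlicz_norm \<nu> \<Phi> g"
proof -
  have fm: "f \<in> borel_measurable borel" using borel_measurable_integrable[OF f] by simp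
  show ?thesis
  proof (rule orlicz_fatou[OF \<Phi> truncated_convolution_measurable(1)[OF fm g]])
    show "orlicz_norm \<nu> \<Phi> (group_convolution m (truncation n f) (truncation n g))
      \<le> ennreal (LINT s|m. cmod (f s)) * orlicz_norm \<nu> \<Phi> g" for n
      by (rule truncated_convolution_norm(1)[OF assms])
  qed (rule AE_I2, rule convolution_eq_0_or_tendsto[OF fm g])
qed

text \<open>The norm inequality bounds the increasing sequence of truncations of \<open>\<bar>f\<bar> * \<bar>g\<bar>\<close> in norm, so it is
finite almost everywhere.\<close>

lemma AE_convolution_integrable:
  fixes \<nu> :: "'g set \<Rightarrow> 'x::complex_banach"
  assumes \<Phi>: "young_function \<Phi>" and \<nu>: "vector_measure \<nu>" and ac: "abs_continuous m \<nu>"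
    and inv: "norm_integral_translation_invariant \<nu>"
    and f: "integrable m f" and g: "g \<in> weak_orlicz_space \<nu> \<Phi>" and x': "x' \<in> dual_unit_ball"
  shows "AE t in variation_measure (\<lambda>A. x' (\<nu> A)). integrable m (\<lambda>s. f s * g (- s + t))"
proof -
  have fm: "f \<in> borel_measurable borel" using borel_measurable_integrable[OF f] by simp
  have gm: "g \<in> borel_measurable borel" and gfin: "orlicz_norm \<nu> \<Phi> g < \<infinity>"
    using g by (auto simp: weak_orlicz_space_def)
  note [measurable] = fm gm
  show ?thesis
    unfolding convolution_integrable_iff[OF fm gm]
  proof (rule luxemburg_bounded_AE[OF \<Phi>])
    show "group_convolution m (abs_truncation n f) (abs_truncation n g)
        \<in> borel_measurable (variation_measure (\<lambda>A. x' (\<nu> A)))" for n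
      using truncated_convolution_measurable(2)[OF fm gm] by simp
    show "incseq (\<lambda>n. cmod (group_convolution m (abs_truncation n f) (abs_truncation n g) t))" for t
      unfolding cmod_abs_truncation_convolution[OF fm gm]
      by (intro incseq_def[THEN iffD2] allI impI integral_mono integrable_truncations fm gm)
        (auto intro!: mult_mono truncation_mono)
    show "luxemburg_norm (variation_measure (\<lambda>A. x' (\<nu> A))) \<Phi>
        (group_convolution m (abs_truncation n f) (abs_truncation n g))
        \<le> ennreal (LINT s|m. cmod (f s)) * orlicz_norm \<nu> \<Phi> g" for n
      by (rule order_trans[OF luxemburg_le_orlicz[OF x'] truncated_convolution_norm(2)[OF \<Phi> \<nu> ac inv f gm]])
    show "ennreal (LINT s|m. cmod (f s)) * orlicz_norm \<nu> \<Phi> g < \<infinity>"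
      using gfin by (simp add: ennreal_mult_less_top)
  qed
qed

text \<open>Approximate \<open>g\<close> in norm by a simple \<open>\<phi>\<close>, and then the bounded function \<open>f * \<phi>\<close> uniformly by a
simple \<open>\<psi>\<close>. The identity \<open>f * g - f * \<phi> = f * (g - \<phi>)\<close> can fail where the integral for \<open>f * g\<close>
diverges, so it is used only almost everywhere.\<close>

lemma convolution_in_orlicz_space:
  fixes \<nu> :: "'g set \<Rightarrow> 'x::complex_banach"
  assumes \<Phi>: "young_function \<Phi>" and \<nu>: "vector_measure \<nu>" and ac: "abs_continuous m \<nu>"
    and inv: "norm_integral_translation_invariant \<nu>"
    and f: "integrable m f" and g: "g \<in> orlicz_space \<nu> \<Phi>" and "\<epsilon> > 0"
  shows "\<exists>\<psi>. simple_function borel \<psi> \<and> orlicz_norm \<nu> \<Phi> (\<lambda>t. group_convolution m f g t - \<psi> t) < ennreal \<epsilon>"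
proof -
  have fm: "f \<in> borel_measurable borel" using borel_measurable_integrable[OF f] by simp
  have gw: "g \<in> weak_orlicz_space \<nu> \<Phi>" using g by (simp add: orlicz_space_def)
  then have gm: "g \<in> borel_measurable borel" by (simp add: weak_orlicz_space_def)
  define L where "L = (LINT s|m. cmod (f s))"
  have L: "L \<ge> 0" by (simp add: L_def)
  \<comment> \<open>With this \<open>\<delta>\<close> the first error is \<open>L \<delta> \<le> \<epsilon> / 2\<close>; the second will be at most \<open>\<epsilon> / 4\<close>, leaving
    room for the strict inequality.\<close>
  define \<delta> where "\<delta> = \<epsilon> / (2 * (L + 1))"
  have "\<delta> > 0" using L \<open>\<epsilon> > 0\<close> by (simp add: \<delta>_def)
  then obtain \<phi> where \<phi>: "simple_function borel \<phi>" "orlicz_norm \<nu> \<Phi> (\<lambda>t. g t - \<phi> t) < ennreal \<delta>"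
    using g unfolding orlicz_space_def by blast
  have \<phi>m: "\<phi> \<in> borel_measurable borel" by (rule borel_measurable_simple_function[OF \<phi>(1)])
  have "bounded (range \<phi>)" using simple_function_borelD(1)[OF \<phi>(1)] by (rule finite_imp_bounded)
  then obtain C where C: "\<And>t. cmod (\<phi> t) \<le> C" unfolding bounded_iff by blast
  note int\<phi> = integrable_convolution_bounded[OF f \<phi>m C]
  have conv\<phi>: "cmod (group_convolution m f \<phi> t) \<le> L * C" for t
  proof -
    have "cmod (group_convolution m f \<phi> t) \<le> (LINT s|m. cmod (f s) * C)"
      unfolding group_convolution_def
      by (rule norm_integral_le_integral[OF int\<phi>]) (use f in \<open>auto simp: norm_mult intro: mult_left_mono C\<close>)
    then show ?thesis by (simp add: L_def)
  qed
  have conv\<phi>m: "group_convolution m f \<phi> \<in> borel_measurable borel" by (rule convolution_measurable[OF fm \<phi>m])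
  obtain B where B: "B \<ge> 0" "\<And>A. A \<in> sets borel \<Longrightarrow> norm (\<nu> A) \<le> B"
    using vector_measure_bounded[OF \<nu> ac] by blast
  have total: "emeasure (variation_measure (\<lambda>A. x' (\<nu> A))) UNIV \<le> ennreal (4 * B)" if x': "x' \<in> dual_unit_ball" for x'
  proof -
    have vm: "vector_measure (\<lambda>A. x' (\<nu> A))" by (rule vector_measure_functional[OF \<nu> x'])
    have "cmod (x' (\<nu> A)) \<le> B" if "A \<in> sets borel" for A
      by (rule order_trans[OF dual_unit_ballD(3)[OF x'] B(2)[OF that]])
    from variation_le_of_bounded[OF vm this] show ?thesis by (simp add: emeasure_variation_measure[OF vm])
  qed
  obtain \<eta> where \<eta>: "\<eta> > 0" "\<And>(\<mu> :: 'g measure) h. emeasure \<mu> (space \<mu>) \<le> ennreal (4 * B) \<Longrightarrow>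
      (\<And>t. cmod (h t) \<le> \<eta>) \<Longrightarrow> luxemburg_norm \<mu> \<Phi> h \<le> ennreal (\<epsilon> / 4)"
    using luxemburg_small[OF \<Phi>, of "4 * B" "\<epsilon> / 4"] B(1) \<open>\<epsilon> > 0\<close> by auto
  obtain \<psi> where \<psi>: "simple_function borel \<psi>" "\<And>t. cmod (group_convolution m f \<phi> t - \<psi> t) \<le> \<eta>"
    using uniform_simple_approximation[OF conv\<phi>m conv\<phi> \<eta>(1)] by blast
  have \<psi>m: "\<psi> \<in> borel_measurable borel" by (rule borel_measurable_simple_function[OF \<psi>(1)])
  let ?d = "group_convolution m f (\<lambda>t. g t - \<phi> t)"
  have dm: "?d \<in> borel_measurable borel" using gm \<phi>m by (intro convolution_measurable fm) simp
  have "orlicz_norm \<nu> \<Phi> (\<lambda>t. group_convolution m f g t - \<psi> t) \<le> ennreal (L * \<delta>) + ennreal (\<epsilon> / 4)"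
  proof (rule orlicz_leI)
    fix x' :: "'x \<Rightarrow> complex" assume x': "x' \<in> dual_unit_ball"
    let ?\<mu> = "variation_measure (\<lambda>A. x' (\<nu> A))"
    have "AE t in ?\<mu>. integrable m (\<lambda>s. f s * g (- s + t))"
      by (rule AE_convolution_integrable[OF \<Phi> \<nu> ac inv f gw x'])
    then have "AE t in ?\<mu>. cmod (group_convolution m f g t - \<psi> t) \<le> cmod (?d t + (group_convolution m f \<phi> t - \<psi> t))"
    proof eventually_elim
      fix t assume "integrable m (\<lambda>s. f s * g (- s + t))"
      then have "?d t = group_convolution m f g t - group_convolution m f \<phi> t"
        unfolding group_convolution_def right_diff_distrib
        using int\<phi>[of t] by (rule Bochner_Integration.integral_diff)
      then show "cmod (group_convolution m f g t - \<psi> t) \<le> cmod (?d t + (group_convolution m f \<phi> t - \<psi> t))" by simp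
    qed
    then have "luxemburg_norm ?\<mu> \<Phi> (\<lambda>t. group_convolution m f g t - \<psi> t)
        \<le> luxemburg_norm ?\<mu> \<Phi> (\<lambda>t. ?d t + (group_convolution m f \<phi> t - \<psi> t))"
      by (rule luxemburg_mono_AE[OF \<Phi>])
    also have "\<dots> \<le> luxemburg_norm ?\<mu> \<Phi> ?d + luxemburg_norm ?\<mu> \<Phi> (\<lambda>t. group_convolution m f \<phi> t - \<psi> t)"
      using dm conv\<phi>m \<psi>m by (intro luxemburg_triangle[OF \<Phi>]) auto
    also have "\<dots> \<le> ennreal (L * \<delta>) + ennreal (\<epsilon> / 4)"
    proof (rule add_mono)
      have "luxemburg_norm ?\<mu> \<Phi> ?d \<le> orlicz_norm \<nu> \<Phi> ?d" by (rule luxemburg_le_orlicz[OF x'])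
      also have "\<dots> \<le> ennreal L * orlicz_norm \<nu> \<Phi> (\<lambda>t. g t - \<phi> t)"
        unfolding L_def using gm \<phi>m by (intro convolution_norm[OF \<Phi> \<nu> ac inv f]) simp
      also have "\<dots> \<le> ennreal L * ennreal \<delta>" using \<phi>(2) by (intro mult_left_mono) auto
      finally show "luxemburg_norm ?\<mu> \<Phi> ?d \<le> ennreal (L * \<delta>)" using L \<open>\<delta> > 0\<close> by (simp add: ennreal_mult)
      show "luxemburg_norm ?\<mu> \<Phi> (\<lambda>t. group_convolution m f \<phi> t - \<psi> t) \<le> ennreal (\<epsilon> / 4)"
        by (rule \<eta>(2)) (use total[OF x'] \<psi>(2) in auto)
    qed
    finally show "luxemburg_norm ?\<mu> \<Phi> (\<lambda>t. group_convolution m f g t - \<psi> t) \<le> ennreal (L * \<delta>) + ennreal (\<epsilon> / 4)" .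
  qed
  also have "\<dots> < ennreal \<epsilon>"
  proof -
    have "L * \<delta> \<le> \<epsilon> / 2" using L \<open>\<epsilon> > 0\<close> by (simp add: \<delta>_def field_simps)
    then have "L * \<delta> + \<epsilon> / 4 < \<epsilon>" using \<open>\<epsilon> > 0\<close> by simp
    then show ?thesis using L \<open>\<delta> > 0\<close> \<open>\<epsilon> > 0\<close>
      by (simp add: ennreal_plus[symmetric] ennreal_less_iff del: ennreal_plus)
  qed
  finally show ?thesis using \<psi>(1) by blast
qed

end

section \<open>The convolution inequality\<close>

theorem theorem4p4:
  fixes m :: "'g::{topological_group_add, t2_space} measure"
    and \<nu> :: "'g set \<Rightarrow> 'x::complex_banach"
    and \<Phi> :: "real \<Rightarrow> real"
    and f g :: "'g \<Rightarrow> complex"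
  assumes "compact (UNIV :: 'g set)"
    and "normalized_haar_measure m"
    and "young_function \<Phi>"
    and "vector_measure \<nu>"
    and "\<exists>A \<in> sets borel. \<nu> A \<noteq> 0"
    and "abs_continuous m \<nu>"
    and "norm_integral_translation_invariant \<nu>"
    and "integrable m f"
    and "g \<in> weak_orlicz_space \<nu> \<Phi>"
  shows "group_convolution m f g \<in> weak_orlicz_space \<nu> \<Phi> \<and>
    orlicz_norm \<nu> \<Phi> (group_convolution m f g)
      \<le> ennreal (LINT s|m. cmod (f s)) * orlicz_norm \<nu> \<Phi> g \<and>
    (g \<in> orlicz_space \<nu> \<Phi> \<longrightarrow> group_convolution m f g \<in> orlicz_space \<nu> \<Phi>)"
proof -
  interpret compact_haar m using assms(1,2) by unfold_locales
  have f: "f \<in> borel_measurable borel" using borel_measurable_integrable[OF assms(8)] by simp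
  have g: "g \<in> borel_measurable borel" "orlicz_norm \<nu> \<Phi> g < \<infinity>"
    using assms(9) by (auto simp: weak_orlicz_space_def)
  have norm: "orlicz_norm \<nu> \<Phi> (group_convolution m f g)
      \<le> ennreal (LINT s|m. cmod (f s)) * orlicz_norm \<nu> \<Phi> g"
    by (rule convolution_norm[OF assms(3,4,6,7,8) g(1)])
  also have "\<dots> < \<infinity>" using g(2) by (simp add: ennreal_mult_less_top)
  finally have weak: "group_convolution m f g \<in> weak_orlicz_space \<nu> \<Phi>"
    using convolution_measurable[OF f g(1)] by (simp add: weak_orlicz_space_def)
  have "group_convolution m f g \<in> orlicz_space \<nu> \<Phi>" if "g \<in> orlicz_space \<nu> \<Phi>"
    using weak convolution_in_orlicz_space[OF assms(3,4,6,7,8) that] by (simp add: orlicz_space_def)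
  with weak norm show ?thesis by blast
qed

end
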